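(* Let $k$ be odd. Suppose there exists a $k$-nice sequence of subsets of finite fields. Then for infinitely many positive integers $t$ we have $P(2^t-1)\ge (t/2)^{1+1/(k-2)}$.
   Context: $P(m)$ denotes the largest prime factor of $m$. $\mathbb{F}_q$ is the finite field with $q$ elements and $\mathbb{F}_q^*$ its multiplicative group; $(u,v)=\sum_i u_iv_i$ is the dot product on $\mathbb{F}_q^m$. For a subset $S_1\subseteq\mathbb{F}_q$ and $\alpha,\beta\in\mathbb{F}_q$, $\alpha+\beta S_1=\{\alpha+\beta s: s\in S_1\}$. A set $S\subseteq\mathbb{F}_q^*$ is called $t$ combinatorially nice if for some constant $c>0$ and every positive integer $m$ there exist two collections of $n=\lfloor cm^t\rfloor$ vectors $u_1,\dots,u_n$ and $v_1,\dots,v_n$ in $\mathbb{F}_q^m$ such that $(u_i,v_i)=0$ for all $i\in[n]$ and $(u_j,v_i)\in S$ for all $i\ne j$ in $[n]$. A set $S\subseteq\mathbb{F}_q^*$ is called $k$ algebraically nice if $k$ is odd and there exist an odd $k'\le k$ and sets $S_0,S_1\subseteq\mathbb{F}_q$ such that $S_0\neq\emptyset$, $|S_1|=k'$, and for all $\alpha\in\mathbb{F}_q$ and $\beta\in S$ the number $|S_0\cap(\alpha+\beta S_1)|$ is even. A sequence $\{S_i\subseteq\mathbb{F}_{q_i}^*\}_{i\ge1}$ of subsets of finite fields is $k$-nice if every $S_i$ is $k$ algebraically nice and $t(i)$ combinatorially nice, for some integer-valued strictly increasing function $t$. *)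

theory Defs
  imports
    "HOL-Algebra.Ring"
    "HOL-Library.FuncSet"
    "HOL-Computational_Algebra.Primes"
    Complex_Main
begin

(* Unspecified for m = 0 and m = 1, which have no largest prime factor. *)
definition largest_prime_factor :: "nat \<Rightarrow> nat" where
  "largest_prime_factor m = Max (prime_factors m)"

(* The fields of a sequence vary with the index, so they are HOL-Algebra records rather than
   types; F^m is the set of extensional functions from {1..m} to the carrier. *)
definition vecs :: "('a, 'b) ring_scheme \<Rightarrow> nat \<Rightarrow> (nat \<Rightarrow> 'a) set" where
  "vecs F m = {1..m} \<rightarrow>\<^sub>E carrier F"

definition dot :: "('a, 'b) ring_scheme \<Rightarrow> nat \<Rightarrow> (nat \<Rightarrow> 'a) \<Rightarrow> (nat \<Rightarrow> 'a) \<Rightarrow> 'a" where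
  "dot F m u v = (\<Oplus>\<^bsub>F\<^esub>i\<in>{1..m}. u i \<otimes>\<^bsub>F\<^esub> v i)"

definition affine_image :: "('a, 'b) ring_scheme \<Rightarrow> 'a \<Rightarrow> 'a \<Rightarrow> 'a set \<Rightarrow> 'a set" where
  "affine_image F \<alpha> \<beta> S\<^sub>1 = (\<lambda>s. \<alpha> \<oplus>\<^bsub>F\<^esub> \<beta> \<otimes>\<^bsub>F\<^esub> s) ` S\<^sub>1"

definition combinatorially_nice ::
    "('a, 'b) ring_scheme \<Rightarrow> real \<Rightarrow> 'a set \<Rightarrow> bool" where
  "combinatorially_nice F t S \<longleftrightarrow>
     S \<subseteq> carrier F - {\<zero>\<^bsub>F\<^esub>} \<and>
     (\<exists>c::real. c > 0 \<and>
       (\<forall>m::nat. m > 0 \<longrightarrow>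
         (let n = nat \<lfloor>c * real m powr t\<rfloor> in
           \<exists>u v :: nat \<Rightarrow> nat \<Rightarrow> 'a.
             (\<forall>i\<in>{1..n}. u i \<in> vecs F m \<and> v i \<in> vecs F m) \<and>
             (\<forall>i\<in>{1..n}. dot F m (u i) (v i) = \<zero>\<^bsub>F\<^esub>) \<and>
             (\<forall>i\<in>{1..n}. \<forall>j\<in>{1..n}. i \<noteq> j \<longrightarrow> dot F m (u j) (v i) \<in> S))))"

definition algebraically_nice ::
    "('a, 'b) ring_scheme \<Rightarrow> nat \<Rightarrow> 'a set \<Rightarrow> bool" where
  "algebraically_nice F k S \<longleftrightarrow>
     S \<subseteq> carrier F - {\<zero>\<^bsub>F\<^esub>} \<and>
     odd k \<and>
     (\<exists>k' S\<^sub>0 S\<^sub>1. odd k' \<and> k' \<le> k \<and>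
       S\<^sub>0 \<subseteq> carrier F \<and> S\<^sub>1 \<subseteq> carrier F \<and> S\<^sub>0 \<noteq> {} \<and> card S\<^sub>1 = k' \<and>
       (\<forall>\<alpha>\<in>carrier F. \<forall>\<beta>\<in>S. even (card (S\<^sub>0 \<inter> affine_image F \<alpha> \<beta> S\<^sub>1))))"

definition nice_sequence ::
    "nat \<Rightarrow> (nat \<Rightarrow> ('a, 'b) ring_scheme) \<Rightarrow> (nat \<Rightarrow> 'a set) \<Rightarrow> bool" where
  "nice_sequence k F S \<longleftrightarrow>
     (\<forall>i\<ge>1. field (F i) \<and> finite (carrier (F i)) \<and> S i \<subseteq> carrier (F i) - {\<zero>\<^bsub>F i\<^esub>}) \<and>
     (\<exists>t :: nat \<Rightarrow> int. strict_mono_on {1..} t \<and>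
       (\<forall>i\<ge>1. algebraically_nice (F i) k (S i) \<and>
               combinatorially_nice (F i) (real_of_int (t i)) (S i)))"

end

theory Submission
  imports Defs "HOL-Number_Theory.Residues"
begin

text \<open>
  Let $F$ have characteristic $p$ and let $S_0, S_1$ witness the algebraic niceness of $S$.
  A suitable additive map $f : F \to \mathbb{Z}/p$ pushes the parity condition forward: the set
  $A$ of residues with an odd number of preimages in $S_0$ is nonempty, and for each $\beta \in S$
  the number of $s \in S_1$ with $y + f(\beta s) \in A$ is even for all $y$.

  Two consequences follow. First, the maps $\beta \mapsto f(\beta s)$ for $s \in S_1$ have no common
  zero on $S$, so $\prod_s (1 - f(\beta s)^{p-1})$ separates $0$ from $S$; evaluated at the inner
  products of the vectors it gives an identity matrix modulo $p$ of rank polynomial in $m$ of degree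
  at most $(p-1)k$. Hence $t \le (p-1)k$ and $p$ is unbounded along the sequence.

  Second, by simultaneous approximation the exponents $f(\beta s)$ may be multiplied by a common unit
  and translated into an interval of length $2 p^{1-1/(k-1)}$. The sets of residues satisfying the
  parity condition then form an $\mathbb{F}_2$-space of dimension $d$ with
  $0 < d \le 2 p^{1-1/(k-1)}$, on which the cyclic shift has no nonzero fixed point, so
  $p \mid 2^d - 1$.
\<close>

section \<open>Counting modulo a prime, and families closed under symmetric difference\<close>

text \<open>Orbits of \<open>g\<close> on \<open>A\<close> have length 1 or \<open>p\<close>: the
  points that are moved split under the orbit relation \<open>r\<close> into classes of exactly
  \<open>p\<close> elements, so only the fixed points count modulo \<open>p\<close>. It serves for
  the shift of period \<open>p\<close> and, with 2 in place of \<open>p\<close>, for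
  involutions.\<close>

lemma cong_card_fixpoints:
  assumes "prime p" "finite A" and maps: "\<And>x. x \<in> A \<Longrightarrow> g x \<in> A"
    and period: "\<And>x. x \<in> A \<Longrightarrow> (g ^^ p) x = x"
  shows "[card A = card {x \<in> A. g x = x}] (mod p)"
proof -
  define N where "N = {x \<in> A. g x \<noteq> x}"
  define r where "r = {(x, y). x \<in> N \<and> y \<in> N \<and> (\<exists>n. y = (g ^^ n) x)}"
  have p0: "p > 0"
    using \<open>prime p\<close> prime_gt_0_nat by blast
  have iter: "(g ^^ n) x \<in> A" if "x \<in> A" for n x
    by (induction n) (auto simp: that maps)
  have period': "(g ^^ (n mod p)) x = (g ^^ n) x" if "x \<in> A" for n x
    using funpow_mod_eq[OF period[OF that]] .
  have return: "\<exists>m. (g ^^ m) ((g ^^ n) x) = x" if "x \<in> A" for n x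
  proof -
    \<comment> \<open>The \<open>n * (p - 1)\<close> further steps complete \<open>n * p\<close>
      steps, a multiple of the period.\<close>
    have "(g ^^ (n * (p - 1))) ((g ^^ n) x) = (g ^^ (n * p)) x"
      using p0 by (simp flip: funpow_add comp_apply[of "g ^^ _"] add: diff_mult_distrib2)
    also have "\<dots> = (g ^^ (n * p mod p)) x"
      using period'[OF that, of "n * p"] by simp
    finally show ?thesis by auto
  qed
  have iterN: "(g ^^ n) x \<in> N" if "x \<in> N" for n x
  proof -
    have "x \<in> A" "g x \<noteq> x" using that by (auto simp: N_def)
    obtain m where m: "(g ^^ m) ((g ^^ n) x) = x" using return[OF \<open>x \<in> A\<close>] by blast
    have "g ((g ^^ n) x) \<noteq> (g ^^ n) x"
    proof
      assume "g ((g ^^ n) x) = (g ^^ n) x"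
      then have "(g ^^ m) (g ((g ^^ n) x)) = x" using m by simp
      moreover have "(g ^^ m) (g ((g ^^ n) x)) = g ((g ^^ m) ((g ^^ n) x))"
        by (simp add: funpow_swap1)
      ultimately show False using m \<open>g x \<noteq> x\<close> by simp
    qed
    then show ?thesis using iter[OF \<open>x \<in> A\<close>] by (auto simp: N_def)
  qed
  have "finite N" using \<open>finite A\<close> by (simp add: N_def)
  have equiv: "equiv N r"
  proof (rule equivI)
    show "r \<subseteq> N \<times> N" by (auto simp: r_def)
    show "refl_on N r"
      by (auto simp: refl_on_def r_def intro: exI[of _ 0])
    show "sym r"
    proof (rule symI)
      fix x y assume "(x, y) \<in> r"
      then show "(y, x) \<in> r" using return[of x] by (auto simp: r_def N_def) metis
    qed
    show "trans r"
    proof (rule transI)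
      fix x y z assume "(x, y) \<in> r" "(y, z) \<in> r"
      then obtain m n where "x \<in> N" "z \<in> N" "z = (g ^^ n) ((g ^^ m) x)"
        by (auto simp: r_def)
      then show "(x, z) \<in> r"
        by (auto simp: r_def funpow_add intro!: exI[of _ "n + m"])
    qed
  qed
  have "p dvd card N"
  proof (rule equiv_imp_dvd_card[OF \<open>finite N\<close> equiv])
    fix X assume "X \<in> N // r"
    then obtain x where x: "x \<in> N" "X = r `` {x}" by (auto elim: quotientE)
    then have xA: "x \<in> A" and gx: "g x \<noteq> x" by (auto simp: N_def)
    have "X = (\<lambda>n. (g ^^ n) x) ` {..<p}"
    proof
      show "X \<subseteq> (\<lambda>n. (g ^^ n) x) ` {..<p}"
      proof
        fix y assume "y \<in> X"
        then obtain n where "y = (g ^^ n) x" using x by (auto simp: r_def)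
        then have "y = (g ^^ (n mod p)) x" using period'[OF xA] by simp
        then show "y \<in> (\<lambda>n. (g ^^ n) x) ` {..<p}" using p0 by auto
      qed
      show "(\<lambda>n. (g ^^ n) x) ` {..<p} \<subseteq> X"
        using x iterN by (auto simp: r_def)
    qed
    moreover have "inj_on (\<lambda>n. (g ^^ n) x) {..<p}"
    proof (rule linorder_inj_onI)
      fix i j assume "i < j" and j: "j \<in> {..<p}"
      show "(g ^^ i) x \<noteq> (g ^^ j) x"
      proof
        assume eq: "(g ^^ i) x = (g ^^ j) x"
        obtain m where m: "(g ^^ m) ((g ^^ i) x) = x" using return[OF xA] by blast
        have "m + j = (j - i) + (m + i)" using \<open>i < j\<close> by simp
        then have "(g ^^ (m + j)) x = (g ^^ ((j - i) + (m + i))) x" by metis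
        then have "(g ^^ m) ((g ^^ j) x) = (g ^^ (j - i)) ((g ^^ m) ((g ^^ i) x))"
          by (simp only: funpow_add comp_apply)
        then have fix1: "(g ^^ (j - i)) x = x" using eq m by simp
        have fixn: "(g ^^ (n * (j - i))) x = x" for n
          by (induction n) (simp_all add: funpow_add fix1)
        \<comment> \<open>With \<open>n\<close> inverse to \<open>j - i\<close> modulo
          \<open>p\<close>, the \<open>n * (j - i)\<close> steps that fix \<open>x\<close> amount to
          a single step, although \<open>g\<close> moves \<open>x\<close>.\<close>
        have "\<not> p dvd j - i" using \<open>i < j\<close> j by (auto dest: dvd_imp_le)
        then have "coprime (j - i) p"
          using \<open>prime p\<close> by (metis coprime_commute prime_imp_coprime)
        then obtain n where "[(j - i) * n = 1] (mod p)"
          using cong_solve_coprime_nat by (metis One_nat_def)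
        then have "n * (j - i) mod p = 1 mod p" by (simp add: cong_def mult.commute)
        then have "(g ^^ 1) x = x"
          using fixn[of n] period'[OF xA, of 1] period'[OF xA, of "n * (j - i)"] by metis
        then show False using gx by simp
      qed
    qed auto
    ultimately show "p dvd card X" by (simp add: card_image)
  qed
  moreover have "card A = card N + card {x \<in> A. g x = x}"
    unfolding N_def using \<open>finite A\<close>
    by (subst card_Un_disjoint[symmetric]) (auto intro: arg_cong[where f = card])
  ultimately show ?thesis by (simp add: cong_def mod_add_left_eq[symmetric])
qed

text \<open>\<open>V\<close> is a subspace of the subsets of \<open>X\<close> over the field with
  two elements, and \<open>d\<close> is its dimension. Induction on \<open>X\<close>: the members
  avoiding a new point \<open>a\<close> form a subspace of index one or two.\<close>

lemma card_power2_of_sym_diff_closed: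
  assumes "finite X" "V \<subseteq> Pow X" "V \<noteq> {}"
    and "\<And>A B. A \<in> V \<Longrightarrow> B \<in> V \<Longrightarrow> sym_diff A B \<in> V"
  shows "\<exists>d \<le> card X. card V = 2 ^ d"
  using assms
proof (induction X arbitrary: V rule: finite_induct)
  case empty
  then have "V = {{}}" by auto
  then show ?case by simp
next
  case (insert a X)
  define V0 where "V0 = {A \<in> V. a \<notin> A}"
  obtain C where "C \<in> V" using insert.prems by blast
  then have "{} \<in> V" using insert.prems(3)[of C C] by simp
  then have "V0 \<noteq> {}" by (auto simp: V0_def)
  moreover have "V0 \<subseteq> Pow X" using insert.prems(1) by (auto simp: V0_def)
  moreover have "sym_diff A B \<in> V0" if "A \<in> V0" "B \<in> V0" for A B
    using that insert.prems(3)[of A B] by (auto simp: V0_def)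
  ultimately obtain d where d: "d \<le> card X" "card V0 = 2 ^ d"
    using insert.IH[of V0] by blast
  show ?case
  proof (cases "V0 = V")
    case True
    then show ?thesis using d insert.hyps by (intro exI[of _ d]) auto
  next
    case False
    then obtain B where B: "B \<in> V" "a \<in> B" by (auto simp: V0_def)
    \<comment> \<open>Adding a member \<open>B\<close> that contains \<open>a\<close> exchanges
      \<open>V0\<close> with its complement in \<open>V\<close>.\<close>
    have "bij_betw (\<lambda>A. sym_diff A B) V0 (V - V0)"
    proof (rule bij_betwI[where g = "\<lambda>A. sym_diff A B"])
      show "(\<lambda>A. sym_diff A B) \<in> V0 \<rightarrow> V - V0"
        using B insert.prems(3) by (auto simp: V0_def)
      show "(\<lambda>A. sym_diff A B) \<in> V - V0 \<rightarrow> V0"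
        using B insert.prems(3) by (auto simp: V0_def)
    qed auto
    then have "card (V - V0) = card V0" using bij_betw_same_card by metis
    moreover have "finite V"
      using insert.prems(1) insert.hyps(1) by (meson finite.insertI finite_Pow_iff finite_subset)
    ultimately have "card V = 2 * card V0"
      using card_Diff_subset[of V0 V] card_mono[of V V0] finite_subset[of V0 V]
      by (auto simp: V0_def)
    then show ?thesis using d insert.hyps by (intro exI[of _ "Suc d"]) auto
  qed
qed

lemma even_card_sym_diff_iff:
  assumes "finite A" "finite B"
  shows "even (card (sym_diff A B)) \<longleftrightarrow> even (card A + card B)"
proof -
  have "card A = card (A - B) + card (A \<inter> B)" "card B = card (B - A) + card (A \<inter> B)"
    using assms by (metis card_Diff_subset_Int card_mono finite_Int inf_le1 le_add_diff_inverse2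
        , metis card_Diff_subset_Int card_mono finite_Int inf_le1 inf_commute le_add_diff_inverse2)
  moreover have "card (sym_diff A B) = card (A - B) + card (B - A)"
    using assms by (intro card_Un_disjoint) auto
  ultimately show ?thesis by (auto simp: even_add)
qed

section \<open>Periodic sets satisfying a parity relation\<close>

text \<open>Encodes a subset of the residues modulo \<open>p\<close> as the union of the
  corresponding residue classes, so that integers can be added without reduction.\<close>

definition periodic :: "nat \<Rightarrow> int set \<Rightarrow> bool" where
  "periodic p A \<longleftrightarrow> (\<forall>x. x mod int p \<in> A \<longleftrightarrow> x \<in> A)"

lemma periodic_cong:
  assumes "periodic p A" "[x = y] (mod int p)"
  shows "x \<in> A \<longleftrightarrow> y \<in> A"
  using assms unfolding periodic_def cong_def by metis

text \<open>Grouping by the value of \<open>b\<close> splits the counted indices into fibres of even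
  size. Over the field with two elements this cancels the exponents of even multiplicity.\<close>

lemma even_card_fibres:
  assumes "finite I" "\<And>v. P v \<Longrightarrow> even (card {s \<in> I. b s = v})"
  shows "even (card {s \<in> I. P (b s)})"
proof -
  let ?S = "{s \<in> I. P (b s)}"
  have "card ?S = (\<Sum>v\<in>b ` ?S. card {x. x \<in> ?S \<and> b x = v})"
    using sum.image_gen[of ?S "\<lambda>_. 1::nat" b] assms(1) by simp
  also have "\<dots> = (\<Sum>v\<in>b ` ?S. card {s \<in> I. b s = v})"
    by (intro sum.cong arg_cong[where f = card]) auto
  also have "even \<dots>" by (rule dvd_sum) (use assms(2) in auto)
  finally show ?thesis .
qed

text \<open>The relation is a linear recurrence over the field with two elements whose leading term is the
  largest exponent \<open>j\<close> of odd multiplicity, so a solution is determined by its first \<open>j\<close> values.\<close>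

lemma annihilator_exponent:
  fixes b :: "'s \<Rightarrow> nat"
  assumes "prime p" "finite I" "odd (card I)" and bD: "\<And>s. s \<in> I \<Longrightarrow> b s \<le> D"
    and A: "periodic p A" "A \<noteq> {}" "\<And>y. even (card {s \<in> I. y + int (b s) \<in> A})"
  shows "\<exists>d. 0 < d \<and> d \<le> D \<and> p dvd 2 ^ d - 1"
proof -
  define V where "V = {B. periodic p B \<and> (\<forall>y. even (card {s \<in> I. y + int (b s) \<in> B}))}"
  \<comment> \<open>Since \<open>b\<close> may repeat values, only the exponents of odd multiplicity
    survive modulo 2. Some do survive, because \<open>card I\<close> is odd.\<close>
  define J where "J = {v \<in> b ` I. odd (card {s \<in> I. b s = v})}"
  define j where "j = Max J"
  have p0: "p > 0"
    using \<open>prime p\<close> prime_gt_0_nat by blast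
  have "finite J" using \<open>finite I\<close> by (simp add: J_def)
  have "J \<noteq> {}"
  proof
    assume "J = {}"
    then have "even (card {s \<in> I. b s = v})" for v
    proof (cases "v \<in> b ` I")
      case False
      then have "{s \<in> I. b s = v} = {}" by auto
      then show ?thesis by (metis card.empty even_zero)
    qed (auto simp: J_def)
    then have "even (card {s \<in> I. True})"
      using even_card_fibres[OF \<open>finite I\<close>, of "\<lambda>_. True" b] by simp
    then show False using \<open>odd (card I)\<close> by simp
  qed
  then have "j \<in> J" using \<open>finite J\<close> by (simp add: j_def)
  then have j: "odd (card {s \<in> I. b s = j})" "j \<le> D" using bD by (auto simp: J_def)
  have j_max: "even (card {s \<in> I. b s = v})" if "v > j" for v
  proof (cases "v \<in> b ` I")
    case True
    show ?thesis
    proof (rule ccontr)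
      assume "\<not> ?thesis"
      then have "v \<in> J" using True by (simp add: J_def)
      then show False using that Max_ge[OF \<open>finite J\<close> \<open>v \<in> J\<close>] by (simp add: j_def)
    qed
  next
    case False
    then have "{s \<in> I. b s = v} = {}" by auto
    then show ?thesis by (metis card.empty even_zero)
  qed

  \<comment> \<open>Strong induction on the position \<open>n\<close>: in the relation at
    \<open>y = n - j\<close> the terms with exponent below \<open>j\<close> vanish by induction,
    those above \<open>j\<close> cancel modulo 2, and an odd number of copies of the value at
    \<open>n\<close> remains, so this value is 0.\<close>
  have rec: "B = {}" if B: "B \<in> V" "B \<inter> {0..<int j} = {}" for B
  proof -
    have nat: "int n \<notin> B" for n
    proof (induction n rule: less_induct)
      case (less n)
      show ?case
      proof (cases "n < j")
        case True
        then show ?thesis using B(2) by auto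
      next
        case False
        define y where "y = int (n - j)"
        have yj: "y + int j = int n" using False by (simp add: y_def)
        show ?thesis
        proof
          assume n: "int n \<in> B"
          have low: "y + int v \<notin> B" if "v < j" for v
            using less[of "n - j + v"] that False by (simp add: y_def algebra_simps)
          have "{s \<in> I. y + int (b s) \<in> B} =
              {s \<in> I. b s = j} \<union> {s \<in> I. b s > j \<and> y + int (b s) \<in> B}"
          proof -
            have "y + int (b s) \<in> B \<longleftrightarrow> b s = j \<or> b s > j \<and> y + int (b s) \<in> B" for s
              using low[of "b s"] n yj by (cases "b s" j rule: linorder_cases) simp_all
            then show ?thesis by blast
          qed
          moreover have "even (card {s \<in> I. b s > j \<and> y + int (b s) \<in> B})"
            using even_card_fibres[OF \<open>finite I\<close>, of "\<lambda>v. v > j \<and> y + int v \<in> B" b] j_max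
            by blast
          moreover have "card ({s \<in> I. b s = j} \<union> {s \<in> I. b s > j \<and> y + int (b s) \<in> B}) =
              card {s \<in> I. b s = j} + card {s \<in> I. b s > j \<and> y + int (b s) \<in> B}"
            using \<open>finite I\<close> by (intro card_Un_disjoint) auto
          moreover have "even (card {s \<in> I. y + int (b s) \<in> B})"
            using B(1) by (simp add: V_def)
          ultimately show False using j(1) by simp
        qed
      qed
    qed
    have "x \<notin> B" for x
    proof -
      have "x mod int p \<notin> B" using nat[of "nat (x mod int p)"] p0 by simp
      then show ?thesis using B(1) by (simp add: V_def periodic_def)
    qed
    then show ?thesis by blast
  qed

  have closed: "sym_diff B C \<in> V" if "B \<in> V" "C \<in> V" for B C
  proof -
    have "even (card {s \<in> I. y + int (b s) \<in> sym_diff B C})" for y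
    proof -
      have "{s \<in> I. y + int (b s) \<in> sym_diff B C} =
          sym_diff {s \<in> I. y + int (b s) \<in> B} {s \<in> I. y + int (b s) \<in> C}" by auto
      then show ?thesis
        using that \<open>finite I\<close> by (simp add: even_card_sym_diff_iff V_def)
    qed
    then show ?thesis using that by (auto simp: V_def periodic_def)
  qed
  have inj: "inj_on (\<lambda>B. B \<inter> {0..<int j}) V"
  proof (rule inj_onI)
    fix B C assume "B \<in> V" "C \<in> V" "B \<inter> {0..<int j} = C \<inter> {0..<int j}"
    then have "sym_diff B C = {}" using rec[OF closed[of B C]] by blast
    then show "B = C" by auto
  qed
  have "A \<in> V" using A by (simp add: V_def)
  then have "{} \<in> V" using closed[of A A] by simp
  define V' where "V' = (\<lambda>B. B \<inter> {0..<int j}) ` V"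
  have "\<exists>d \<le> card {0..<int j}. card V' = 2 ^ d"
  proof (rule card_power2_of_sym_diff_closed)
    fix B' C' assume "B' \<in> V'" "C' \<in> V'"
    then obtain B C where BC: "B \<in> V" "B' = B \<inter> {0..<int j}" "C \<in> V" "C' = C \<inter> {0..<int j}"
      by (auto simp: V'_def)
    then have "sym_diff B' C' = sym_diff B C \<inter> {0..<int j}" by auto
    then show "sym_diff B' C' \<in> V'" using closed BC by (simp add: V'_def)
  qed (use \<open>A \<in> V\<close> in \<open>auto simp: V'_def\<close>)
  then obtain d where d: "d \<le> j" "card V = 2 ^ d"
    using card_image[OF inj] by (auto simp: V'_def)
  then have "finite V" by (simp add: card_ge_0_finite)

  define g where "g = (\<lambda>B. {x :: int. x + 1 \<in> B})"
  have iter: "(g ^^ n) B = {x. x + int n \<in> B}" for n B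
    by (induction n) (auto simp: g_def algebra_simps)
  have "[card V = card {B \<in> V. g B = B}] (mod p)"
  proof (rule cong_card_fixpoints[OF \<open>prime p\<close> \<open>finite V\<close>])
    fix B assume B: "B \<in> V"
    have "x mod int p + 1 \<in> B \<longleftrightarrow> x + 1 \<in> B" for x
      using B by (intro periodic_cong[of p]) (auto simp: V_def cong_def mod_add_left_eq)
    moreover have "even (card {s \<in> I. y + int (b s) + 1 \<in> B})" for y
    proof -
      have "{s \<in> I. y + int (b s) + 1 \<in> B} = {s \<in> I. (y + 1) + int (b s) \<in> B}"
        by (simp add: algebra_simps)
      then show ?thesis using B by (simp add: V_def)
    qed
    ultimately show "g B \<in> V" by (simp add: V_def g_def periodic_def)
    have "x + int p \<in> B \<longleftrightarrow> x \<in> B" for x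
      using B by (intro periodic_cong[of p]) (auto simp: V_def cong_def)
    then show "(g ^^ p) B = B" by (simp add: iter)
  qed
  \<comment> \<open>A member fixed by the shift is empty or contains every integer; in the latter
    case the relation would count all of \<open>I\<close>, an odd number.\<close>
  moreover have "{B \<in> V. g B = B} = {{}}"
  proof (intro equalityI subsetI)
    fix B assume "B \<in> {B \<in> V. g B = B}"
    then have B: "B \<in> V" "g B = B" by auto
    have gn: "(g ^^ n) B = B" for n by (induction n) (simp_all add: B(2))
    have "B = {}"
    proof (rule ccontr)
      assume "B \<noteq> {}"
      then obtain x where "x \<in> B" by blast
      have "y \<in> B" for y
      proof -
        have "x \<in> (g ^^ nat ((y - x) mod int p)) B" using gn \<open>x \<in> B\<close> by simp
        then have "x + (y - x) mod int p \<in> B" using p0 by (simp add: iter)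
        moreover have "[x + (y - x) mod int p = y] (mod int p)"
          by (simp add: cong_def mod_add_right_eq)
        ultimately show ?thesis using B(1) periodic_cong by (auto simp: V_def)
      qed
      then have "{s \<in> I. 0 + int (b s) \<in> B} = I" by auto
      moreover have "even (card {s \<in> I. 0 + int (b s) \<in> B})" using B(1) by (simp only: V_def) blast
      ultimately show False using \<open>odd (card I)\<close> by simp
    qed
    then show "B \<in> {{}}" by simp
  next
    fix B :: "int set" assume "B \<in> {{}}"
    then show "B \<in> {B \<in> V. g B = B}" using \<open>{} \<in> V\<close> by (auto simp: g_def)
  qed
  ultimately have "[2 ^ d = 1] (mod p)" using d by simp
  then have "p dvd 2 ^ d - 1" by (rule cong_to_1_nat)
  \<comment> \<open>\<open>A\<close> and \<open>{}\<close> are two distinct members, so the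
    dimension is not 0.\<close>
  moreover have "d > 0"
  proof (rule ccontr)
    assume "\<not> d > 0"
    then have "card V = 1" using d by simp
    then show False using \<open>A \<in> V\<close> \<open>{} \<in> V\<close> \<open>A \<noteq> {}\<close> by (auto simp: card_1_singleton_iff)
  qed
  ultimately show ?thesis using d j by (meson le_trans)
qed

section \<open>Simultaneous approximation and the Mersenne divisor\<close>

text \<open>Discrete Blichfeldt argument: the cubes of side \<open>L + 1\<close> at the \<open>p\<close> multiples of \<open>c\<close> overlap.\<close>

lemma simultaneous_approximation:
  fixes c :: "'s \<Rightarrow> int"
  assumes "finite T" "L < p" and large: "p ^ card T < p * (L + 1) ^ card T"
  shows "\<exists>r b. \<not> int p dvd r \<and> (\<forall>s\<in>T. [r * c s = b s] (mod int p) \<and> \<bar>b s\<bar> \<le> int L)"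
proof -
  define X where "X = {0..<int p} \<times> (T \<rightarrow>\<^sub>E {0..int L})"
  define Y where "Y = (T \<rightarrow>\<^sub>E {0..<int p})"
  define f where "f = (\<lambda>(r, y). \<lambda>s\<in>T. (r * c s + y s) mod int p)"
  have p0: "p > 0" using \<open>L < p\<close> by simp
  have "card X = p * (L + 1) ^ card T"
    using \<open>finite T\<close> by (simp add: X_def card_cartesian_product card_PiE nat_add_distrib)
  moreover have "card Y = p ^ card T"
    using \<open>finite T\<close> by (simp add: Y_def card_PiE)
  moreover have "f ` X \<subseteq> Y"
    using p0 by (auto simp: f_def X_def Y_def)
  moreover have "finite Y" using \<open>finite T\<close> by (simp add: Y_def finite_PiE)
  ultimately have "\<not> inj_on f X"
    using card_inj_on_le[of f X Y] large by linarith
  then obtain r y r' y' where ry: "(r, y) \<in> X" "(r', y') \<in> X" "f (r, y) = f (r', y')"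
      "(r, y) \<noteq> (r', y')"
    by (auto simp: inj_on_def)
  have cong: "[(r - r') * c s = y' s - y s] (mod int p)" if "s \<in> T" for s
  proof -
    have "(r * c s + y s) mod int p = (r' * c s + y' s) mod int p"
      using fun_cong[OF ry(3), of s] that by (simp add: f_def)
    then have "int p dvd (r * c s + y s) - (r' * c s + y' s)"
      by (simp add: mod_eq_dvd_iff)
    then show ?thesis by (simp add: cong_iff_dvd_diff algebra_simps)
  qed
  have bound: "\<bar>y' s - y s\<bar> \<le> int L" if "s \<in> T" for s
  proof -
    have "y s \<in> {0..int L}" "y' s \<in> {0..int L}"
      using ry that by (auto simp: X_def)
    then show ?thesis by auto
  qed
  \<comment> \<open>Equal multipliers would leave offsets congruent modulo \<open>p\<close>; these
    differ by at most \<open>L < p\<close>, so the two pairs would coincide.\<close>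
  have "\<not> int p dvd r - r'"
  proof
    assume "int p dvd r - r'"
    then have "r = r'"
      using ry(1,2) mod_eq_dvd_iff[of r "int p" r'] by (auto simp: X_def)
    have "y s = y' s" if "s \<in> T" for s
    proof -
      have "int p dvd y' s - y s"
        using cong[OF that] \<open>r = r'\<close> by (simp add: cong_iff_dvd_diff dvd_diff_commute)
      then show ?thesis
        using bound[OF that] \<open>L < p\<close> zdvd_imp_le[of "int p" "\<bar>y' s - y s\<bar>"] by fastforce
    qed
    then have "y = y'"
      using ry by (intro PiE_ext[of y T _ y']) (auto simp: X_def)
    then show False using ry \<open>r = r'\<close> by simp
  qed
  then show ?thesis
    using cong bound by (intro exI[of _ "r - r'"] exI[of _ "\<lambda>s. y' s - y s"]) blast
qed

text \<open>Subtracting the shift of one index \<open>s0\<close> leaves \<open>card I - 1\<close>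
  differences. A common multiplier makes them small modulo \<open>p\<close>, and dilating
  \<open>A\<close> accordingly preserves the parity relation. The number of differences gives the
  exponent of \<open>p\<close>, the two possible signs give the factor 2.\<close>

lemma mersenne_divisor_of_annihilated:
  fixes c :: "'s \<Rightarrow> int"
  assumes "prime p" and I: "finite I" "odd (card I)" "card I > 1"
    and A: "periodic p A" "A \<noteq> {}" "\<And>y. even (card {s \<in> I. y + c s \<in> A})"
  shows "\<exists>d>0. p dvd 2 ^ d - 1 \<and> real d \<le> 2 * real p powr (1 - 1 / real (card I - 1))"
proof -
  have p1: "p > 1" using \<open>prime p\<close> prime_gt_1_nat by blast
  define N where "N = card I - 1"
  \<comment> \<open>The least \<open>L\<close> with \<open>(L + 1) ^ N > p ^ (N - 1)\<close>;
    multiplied by \<open>p\<close>, this inequality is the pigeonhole condition.\<close>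
  define L where "L = nat \<lfloor>real p powr (1 - 1 / real N)\<rfloor>"
  have "N > 0" using I by (simp add: N_def)
  have L_le: "real L \<le> real p powr (1 - 1 / real N)" by (simp add: L_def)
  have "real p powr (1 - 1 / real N) < real p powr 1"
    using p1 \<open>N > 0\<close> by (intro powr_less_mono) auto
  then have "L < p" using L_le p1 by simp
  have "real p powr (1 - 1 / real N) < real L + 1" unfolding L_def by linarith
  then have "(real p powr (1 - 1 / real N)) ^ N < (real L + 1) ^ N"
    using \<open>N > 0\<close> by (intro power_strict_mono) auto
  also have "(real p powr (1 - 1 / real N)) ^ N = real p powr (real N - 1)"
  proof -
    have "(1 - 1 / real N) * real N = real N - 1"
      using \<open>N > 0\<close> by (simp add: left_diff_distrib)
    then have "real p powr (real N - 1) = (real p powr (1 - 1 / real N)) powr real N"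
      by (simp only: powr_powr)
    then show ?thesis using p1 by (simp add: powr_realpow)
  qed
  also have "real p powr (real N - 1) = real p ^ (N - 1)"
    using p1 \<open>N > 0\<close> powr_realpow[of "real p" "N - 1"] by (simp add: of_nat_diff)
  finally have "real (p ^ (N - 1)) < real ((L + 1) ^ N)" by (simp add: algebra_simps)
  then have "p ^ (N - 1) < (L + 1) ^ N" by (simp only: of_nat_less_iff)
  then have "p * p ^ (N - 1) < p * (L + 1) ^ N" using p1 by simp
  moreover have "p * p ^ (N - 1) = p ^ N" using \<open>N > 0\<close> by (cases N) auto
  ultimately have large: "p ^ N < p * (L + 1) ^ N" by metis

  obtain s0 where "s0 \<in> I" using I by fastforce
  define T where "T = I - {s0}"
  have "card T = N" "finite T" using \<open>s0 \<in> I\<close> I by (simp_all add: T_def N_def)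
  then obtain r b where r: "\<not> int p dvd r"
    and b: "\<And>s. s \<in> T \<Longrightarrow> [r * (c s - c s0) = b s] (mod int p)" "\<And>s. s \<in> T \<Longrightarrow> \<bar>b s\<bar> \<le> int L"
    using simultaneous_approximation[OF \<open>finite T\<close> \<open>L < p\<close>, of "\<lambda>s. c s - c s0"] large by metis
  have "coprime r (int p)"
    using r \<open>prime p\<close> by (metis coprime_commute prime_imp_coprime prime_nat_int_transfer)
  then obtain r' where r': "[r * r' = 1] (mod int p)"
    using cong_solve_coprime_int by blast
  \<comment> \<open>Adding \<open>L\<close> turns the small residues into natural exponents up to
    \<open>2 * L\<close>; the index \<open>s0\<close>, whose difference is 0, gets
    \<open>L\<close>.\<close>
  define b' where "b' = (\<lambda>s. if s = s0 then L else nat (b s + int L))"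
  \<comment> \<open>As \<open>r'\<close> inverts \<open>r\<close> modulo \<open>p\<close>, this is
    the dilation of \<open>A\<close> by \<open>r\<close>.\<close>
  define A' where "A' = {x. r' * x \<in> A}"
  have b'_cong: "[int (b' s) = r * (c s - c s0) + int L] (mod int p)" if "s \<in> I" for s
  proof (cases "s = s0")
    case False
    then have "s \<in> T" using that by (simp add: T_def)
    then have "int (b' s) = b s + int L" using False b(2)[of s] by (simp add: b'_def)
    then show ?thesis using cong_add[OF b(1)[OF \<open>s \<in> T\<close>] cong_refl] by (simp add: cong_sym)
  qed (simp add: b'_def)
  have "\<exists>d. 0 < d \<and> d \<le> 2 * L \<and> p dvd 2 ^ d - 1"
  proof (rule annihilator_exponent[OF \<open>prime p\<close> I(1,2)])
    show "b' s \<le> 2 * L" if "s \<in> I" for s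
      using b(2)[of s] that by (auto simp: b'_def T_def)
    show "periodic p A'"
      unfolding periodic_def A'_def mem_Collect_eq
      by (intro allI periodic_cong[OF A(1)]) (simp add: cong_def mod_mult_right_eq)
    obtain a where "a \<in> A" using A(2) by blast
    have "[r' * (r * a) = a] (mod int p)"
      using cong_mult[OF r' cong_refl[of a]] by (simp add: mult_ac)
    then have "r * a \<in> A'"
      using \<open>a \<in> A\<close> periodic_cong[OF A(1)] by (simp add: A'_def)
    then show "A' \<noteq> {}" by blast
    fix y
    have "y + int (b' s) \<in> A' \<longleftrightarrow> (r' * (y + int L) - c s0) + c s \<in> A" if "s \<in> I" for s
    proof -
      have "[r' * (y + int (b' s)) = r' * (y + (r * (c s - c s0) + int L))] (mod int p)"
        by (intro cong_mult cong_add cong_refl b'_cong that)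
      also have "r' * (y + (r * (c s - c s0) + int L)) =
          r' * (y + int L) + (r * r') * (c s - c s0)" by (simp add: algebra_simps)
      also have "[\<dots> = r' * (y + int L) + 1 * (c s - c s0)] (mod int p)"
        by (intro cong_mult cong_add cong_refl r')
      finally have "[r' * (y + int (b' s)) = (r' * (y + int L) - c s0) + c s] (mod int p)"
        by (simp add: algebra_simps)
      then show ?thesis using periodic_cong[OF A(1)] by (simp add: A'_def)
    qed
    then have "{s \<in> I. y + int (b' s) \<in> A'} = {s \<in> I. (r' * (y + int L) - c s0) + c s \<in> A}"
      by blast
    then show "even (card {s \<in> I. y + int (b' s) \<in> A'})" using A(3) by simp
  qed
  then obtain d where "0 < d" "d \<le> 2 * L" "p dvd 2 ^ d - 1" by blast
  moreover from this have "real d \<le> 2 * real L" by linarith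
  ultimately show ?thesis using L_le by (intro exI[of _ d]) (auto simp: N_def)
qed

section \<open>Rank of integer matrices modulo a prime\<close>

text \<open>A decomposition of \<open>M\<close> into \<open>n\<close> products of a function of the
  row and a function of the column, so \<open>n\<close> bounds the rank from above. Entries are
  integers; congruences enter only in the comparison with an identity matrix.\<close>

inductive separable_rank :: "nat \<Rightarrow> ('j \<Rightarrow> 'i \<Rightarrow> int) \<Rightarrow> bool" where
  zero: "separable_rank 0 (\<lambda>j i. 0)"
| step: "separable_rank n M \<Longrightarrow> separable_rank (Suc n) (\<lambda>j i. M j i + a j * b i)"

lemma separable_rank_product: "separable_rank 1 (\<lambda>j i. a j * b i)"
  using separable_rank.step[OF separable_rank.zero, of a b] by simp

lemma separable_rank_const: "separable_rank 1 (\<lambda>j i. c)"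
  using separable_rank_product[of "\<lambda>_. c" "\<lambda>_. 1"] by simp

lemma separable_rank_add:
  assumes "separable_rank n' M'" "separable_rank n M"
  shows "separable_rank (n + n') (\<lambda>j i. M j i + M' j i)"
  using assms(1)
proof induction
  case (step n' M' a b)
  then show ?case
    using separable_rank.step[of "n + n'" "\<lambda>j i. M j i + M' j i" a b] by (simp add: add.assoc)
qed (use assms in simp)

lemma separable_rank_mult_product:
  assumes "separable_rank n M"
  shows "separable_rank n (\<lambda>j i. M j i * (a j * b i))"
  using assms
proof induction
  case (step n M a' b')
  then show ?case
    using separable_rank.step[of n "\<lambda>j i. M j i * (a j * b i)" "\<lambda>j. a' j * a j" "\<lambda>i. b' i * b i"]
    by (simp add: algebra_simps)
qed (simp add: separable_rank.zero)

text \<open>Distributing over the \<open>n'\<close> terms of \<open>M'\<close> leaves entrywise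
  products of \<open>M\<close> with rank-one matrices, each of which keeps the bound
  \<open>n\<close>.\<close>

lemma separable_rank_mult:
  assumes "separable_rank n' M'" "separable_rank n M"
  shows "separable_rank (n * n') (\<lambda>j i. M j i * M' j i)"
  using assms(1)
proof induction
  case zero
  then show ?case by (simp add: separable_rank.zero)
next
  case (step n' M' a b)
  show ?case
    using separable_rank_add[OF separable_rank_mult_product[OF assms(2), of a b] step.IH]
    by (simp add: algebra_simps)
qed

lemma separable_rank_diff:
  assumes "separable_rank n' M'" "separable_rank n M"
  shows "separable_rank (n + n') (\<lambda>j i. M j i - M' j i)"
  using separable_rank_add[OF separable_rank_mult[OF assms(1) separable_rank_const[of "-1"]] assms(2)]
  by simp

lemma separable_rank_sum:
  assumes "finite A" "\<And>x. x \<in> A \<Longrightarrow> separable_rank n (M x)"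
  shows "separable_rank (card A * n) (\<lambda>j i. \<Sum>x\<in>A. M x j i)"
  using assms
proof (induction A rule: finite_induct)
  case (insert x A)
  then show ?case
    using separable_rank_add[of "card A * n" "\<lambda>j i. \<Sum>x\<in>A. M x j i" n "M x"] by simp
qed (simp add: separable_rank.zero)

lemma separable_rank_prod:
  assumes "finite A" "\<And>x. x \<in> A \<Longrightarrow> separable_rank n (M x)"
  shows "separable_rank (n ^ card A) (\<lambda>j i. \<Prod>x\<in>A. M x j i)"
  using assms
proof (induction A rule: finite_induct)
  case empty
  then show ?case using separable_rank_const[of 1] by simp
next
  case (insert x A)
  then show ?case
    using separable_rank_mult[of "n ^ card A" "\<lambda>j i. \<Prod>x\<in>A. M x j i" n "M x"] by simp
qed

lemma separable_rank_power:
  assumes "separable_rank n M"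
  shows "separable_rank (n ^ e) (\<lambda>j i. M j i ^ e)"
  using separable_rank_prod[of "{..<e}" n "\<lambda>_. M"] assms by simp

lemma separable_rankE:
  assumes "separable_rank n M"
  obtains a b where "\<And>j i. M j i = (\<Sum>t<n. a t j * b t i)"
proof -
  have "\<exists>a b. \<forall>j i. M j i = (\<Sum>t<n. a t j * b t i)"
    using assms
  proof induction
    case (step n M a' b')
    then obtain a b where "\<forall>j i. M j i = (\<Sum>t<n. a t j * b t i)" by blast
    then show ?case
      by (intro exI[of _ "a(n := a')"] exI[of _ "b(n := b')"]) simp
  qed simp
  then show thesis using that by blast
qed

text \<open>Pigeonhole in place of linear algebra: a vector of residues indexed by \<open>J\<close>
  can be recovered from its \<open>n\<close> coordinates under \<open>f\<close>, whence
  \<open>p ^ card J \<le> p ^ n\<close>.\<close>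

lemma identity_separable_rank:
  assumes "separable_rank n M" "p > 1" "finite J"
    and ident: "\<And>i j. i \<in> J \<Longrightarrow> j \<in> J \<Longrightarrow> [M j i = of_bool (i = j)] (mod int p)"
  shows "card J \<le> n"
proof -
  obtain a b where M: "\<And>j i. M j i = (\<Sum>t<n. a t j * b t i)"
    using separable_rankE[OF assms(1)] by blast
  define X where "X = (J \<rightarrow>\<^sub>E {0..<int p})"
  define Y where "Y = ({..<n} \<rightarrow>\<^sub>E {0..<int p})"
  define f where "f = (\<lambda>x. \<lambda>t\<in>{..<n}. (\<Sum>j\<in>J. x j * a t j) mod int p)"
  have "inj_on f X"
  proof (rule inj_onI)
    fix x y assume xy: "x \<in> X" "y \<in> X" "f x = f y"
    have "x i = y i" if "i \<in> J" for i
    proof -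
      \<comment> \<open>Column \<open>i\<close> of \<open>M\<close> picks out \<open>z i\<close>
        modulo \<open>p\<close> and, with \<open>M\<close> factored, depends on \<open>z\<close>
        only through the sums that define \<open>f\<close>.\<close>
      have expand: "[z i = (\<Sum>t<n. (\<Sum>j\<in>J. z j * a t j) * b t i)] (mod int p)" for z
      proof -
        have "z i = (\<Sum>j\<in>J. z j * of_bool (i = j))"
          using that \<open>finite J\<close> by (simp add: of_bool_def if_distrib cong: if_cong)
        also have "[\<dots> = (\<Sum>j\<in>J. z j * M j i)] (mod int p)"
          using ident[OF that] by (intro cong_sum cong_mult cong_refl) (metis cong_sym)
        also have "(\<Sum>j\<in>J. z j * M j i) = (\<Sum>t<n. (\<Sum>j\<in>J. z j * a t j) * b t i)"
          unfolding M sum_distrib_left sum_distrib_right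
          by (subst sum.swap) (simp add: mult.assoc)
        finally show ?thesis .
      qed
      have "[(\<Sum>j\<in>J. x j * a t j) = (\<Sum>j\<in>J. y j * a t j)] (mod int p)" if "t < n" for t
        using fun_cong[OF xy(3), of t] that by (simp add: f_def cong_def)
      then have "[(\<Sum>t<n. (\<Sum>j\<in>J. x j * a t j) * b t i) =
          (\<Sum>t<n. (\<Sum>j\<in>J. y j * a t j) * b t i)] (mod int p)"
        by (intro cong_sum[of "{..<n}"] cong_mult[OF _ cong_refl]) auto
      then have "[x i = y i] (mod int p)"
        using expand[of x] expand[of y] by (meson cong_sym cong_trans)
      moreover have "x i \<in> {0..<int p}" "y i \<in> {0..<int p}"
        using xy that by (auto simp: X_def)
      ultimately show ?thesis by (simp add: cong_def)
    qed
    then show "x = y" using xy by (intro PiE_ext[of x J _ y]) (auto simp: X_def)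
  qed
  moreover have "f ` X \<subseteq> Y" using \<open>p > 1\<close> by (auto simp: f_def Y_def restrict_def split: if_splits)
  moreover have "finite Y" by (simp add: Y_def finite_PiE)
  ultimately have "card X \<le> card Y" by (rule card_inj_on_le)
  then have "p ^ card J \<le> p ^ n" using \<open>finite J\<close> by (simp add: X_def Y_def card_PiE)
  then show ?thesis using \<open>p > 1\<close> by simp
qed

section \<open>Double counting, and additive maps to the residues modulo \<open>p\<close>\<close>

lemma sum_card_swap:
  assumes "finite A" "finite B"
  shows "(\<Sum>a\<in>A. card {b \<in> B. P a b}) = (\<Sum>b\<in>B. card {a \<in> A. P a b})"
proof -
  have "(\<Sum>a\<in>A. card {b \<in> B. P a b}) = (\<Sum>a\<in>A. \<Sum>b\<in>B. of_bool (P a b))"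
    using \<open>finite B\<close> by (simp add: Int_def)
  also have "\<dots> = (\<Sum>b\<in>B. \<Sum>a\<in>A. of_bool (P a b))" by (rule sum.swap)
  also have "\<dots> = (\<Sum>b\<in>B. card {a \<in> A. P a b})"
    using \<open>finite A\<close> by (simp add: Int_def)
  finally show ?thesis .
qed

text \<open>A homomorphism from the additive group of \<open>R\<close> to the residues modulo
  \<open>p\<close>. Its values are arbitrary integer representatives, so they can serve directly as
  shifts of periodic sets.\<close>

definition additive_mod :: "('a, 'b) ring_scheme \<Rightarrow> nat \<Rightarrow> ('a \<Rightarrow> int) \<Rightarrow> bool" where
  "additive_mod R p f \<longleftrightarrow>
     (\<forall>x\<in>carrier R. \<forall>y\<in>carrier R. [f (x \<oplus>\<^bsub>R\<^esub> y) = f x + f y] (mod int p))"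

context ring
begin

lemma additive_modD:
  assumes "additive_mod R p f" "x \<in> carrier R" "y \<in> carrier R"
  shows "[f (x \<oplus> y) = f x + f y] (mod int p)"
  using assms by (simp add: additive_mod_def)

lemma additive_mod_zero:
  assumes "additive_mod R p f"
  shows "[f \<zero> = 0] (mod int p)"
  using additive_modD[OF assms, of \<zero> \<zero>] by (simp add: cong_iff_dvd_diff)

lemma additive_mod_minus:
  assumes "additive_mod R p f" "x \<in> carrier R" "y \<in> carrier R"
  shows "[f (x \<ominus> y) = f x - f y] (mod int p)"
proof -
  have "(x \<ominus> y) \<oplus> y = x"
    using assms by (simp add: a_minus_def a_assoc l_neg)
  then have "[f x = f (x \<ominus> y) + f y] (mod int p)"
    using additive_modD[OF assms(1), of "x \<ominus> y" y] assms by simp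
  then show ?thesis by (simp add: cong_iff_dvd_diff dvd_diff_commute algebra_simps)
qed

lemma additive_mod_finsum:
  assumes "additive_mod R p f" "finite A" "g \<in> A \<rightarrow> carrier R"
  shows "[f (\<Oplus>a\<in>A. g a) = (\<Sum>a\<in>A. f (g a))] (mod int p)"
  using assms(2,3)
proof (induction A rule: finite_induct)
  case empty
  then show ?case using additive_mod_zero[OF assms(1)] by simp
next
  case (insert a A)
  then have g: "g \<in> A \<rightarrow> carrier R" "g a \<in> carrier R" by auto
  then have "[f (g a \<oplus> (\<Oplus>a\<in>A. g a)) = f (g a) + f (\<Oplus>a\<in>A. g a)] (mod int p)"
    by (intro additive_modD[OF assms(1)]) auto
  also have "[f (g a) + f (\<Oplus>a\<in>A. g a) = f (g a) + (\<Sum>a\<in>A. f (g a))] (mod int p)"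
    using insert.IH g by (intro cong_add cong_refl) auto
  finally show ?case using insert.hyps g by simp
qed

lemma additive_mod_mult:
  assumes "additive_mod R p f" "a \<in> carrier R"
  shows "additive_mod R p (\<lambda>x. f (a \<otimes> x))"
  using assms by (simp add: additive_mod_def r_distr)

end

section \<open>The characteristic of a finite field, and a linear functional\<close>

context field
begin

text \<open>\<open>p\<close> is the additive order of 1. It is nonzero by finiteness, and prime
  because the multiples of 1 by \<open>a\<close> and by \<open>b\<close> have as product the
  multiple by \<open>a * b\<close>, so that one of them vanishes if the product does.\<close>

lemma finite_field_characteristic:
  assumes "finite (carrier R)"
  obtains p where "prime p" "\<And>x i. x \<in> carrier R \<Longrightarrow> int p dvd i \<Longrightarrow> [i] \<cdot> x = \<zero>"
proof -
  define p where "p = add.ord \<one>"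
  have iff: "[i] \<cdot> \<one> = \<zero> \<longleftrightarrow> int p dvd i" for i :: int
    unfolding p_def by (rule add.int_pow_eq_id) simp
  have "p \<noteq> 0"
    using add.ord_ge_1[of \<one>] assms by (simp add: p_def)
  moreover have "\<not> is_unit p"
  proof
    assume "is_unit p"
    then have "[(1::int)] \<cdot> \<one> = \<zero>" using iff[of 1] by simp
    then show False by (simp add: add.int_pow_1)
  qed
  moreover have "p dvd a \<or> p dvd b" if "p dvd a * b" for a b
  proof -
    have "([int a] \<cdot> \<one>) \<otimes> ([int b] \<cdot> \<one>) = [int a] \<cdot> ([int b] \<cdot> \<one>)"
      by (simp add: add_pow_ldistr_int)
    also have "\<dots> = [(int (a * b))] \<cdot> \<one>"
      by (simp add: add.int_pow_pow mult.commute)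
    also have "\<dots> = \<zero>" using that iff[of "int (a * b)"] by (simp only: int_dvd_int_iff)
    finally have "[int a] \<cdot> \<one> = \<zero> \<or> [int b] \<cdot> \<one> = \<zero>"
      using integral by simp
    then show ?thesis using iff by simp
  qed
  ultimately have "prime p" by (intro Factorial_Ring.primeI prime_elemI) auto
  moreover have "[i] \<cdot> x = \<zero>" if "x \<in> carrier R" "int p dvd i" for x and i :: int
  proof -
    have "[i] \<cdot> x = ([i] \<cdot> \<one>) \<otimes> x" using that by (simp add: add_pow_ldistr_int)
    also have "[i] \<cdot> \<one> = \<zero>" using that iff by simp
    finally show ?thesis using that by simp
  qed
  ultimately show thesis using that by blast
qed

text \<open>A linear functional over the prime field, obtained without a basis: \<open>f x\<close>
  is the multiple of 1 that agrees with \<open>x\<close> modulo a subgroup \<open>H\<close>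
  complementary to the multiples of 1.\<close>

lemma exists_additive_mod:
  assumes "finite (carrier R)" "prime p"
    and char: "\<And>x i. x \<in> carrier R \<Longrightarrow> int p dvd i \<Longrightarrow> [i] \<cdot> x = \<zero>"
  obtains f where "additive_mod R p f" "[f \<one> = 1] (mod int p)"
proof -
  have scale: "[i] \<cdot> x = x" if "x \<in> carrier R" "[i = 1] (mod int p)" for x and i :: int
  proof -
    have "[(1 + (i - 1))] \<cdot> x = [(1::int)] \<cdot> x \<oplus> [(i - 1)] \<cdot> x"
      using that by (intro add.int_pow_mult)
    moreover have "[(i - 1)] \<cdot> x = \<zero>"
      using that by (intro char) (auto simp: cong_iff_dvd_diff)
    ultimately show ?thesis using that by (simp add: add.int_pow_1)
  qed
  have inverse: "\<exists>j. [i * j = 1] (mod int p)" if "\<not> int p dvd i" for i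
  proof -
    have "coprime i (int p)"
      using that \<open>prime p\<close> by (metis coprime_commute prime_imp_coprime prime_nat_int_transfer)
    then show ?thesis by (rule cong_solve_coprime_int)
  qed
  (* A subgroup H maximal among those not containing 1 satisfies F = H + Z 1. *)
  define Hs where "Hs = {H. subgroup H (add_monoid R) \<and> \<one> \<notin> H}"
  have "finite Hs"
    by (rule finite_subset[of _ "Pow (carrier R)"])
      (use assms(1) add.subgroupE(1) in \<open>auto simp: Hs_def\<close>)
  moreover have "{\<zero>} \<in> Hs"
    using add.triv_subgroup by (auto simp: Hs_def)
  ultimately obtain H where "H \<in> Hs" and max: "\<And>K. K \<in> Hs \<Longrightarrow> H \<subseteq> K \<Longrightarrow> H = K"
    using finite_has_maximal[of Hs] by blast
  then have H: "subgroup H (add_monoid R)" "\<one> \<notin> H" by (auto simp: Hs_def)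
  have Hc: "H \<subseteq> carrier R" using subgroup.subset[OF H(1)] by simp
  have H0: "\<zero> \<in> H" using subgroup.one_closed[OF H(1)] by simp
  have Hadd: "x \<oplus> y \<in> H" if "x \<in> H" "y \<in> H" for x y
    using subgroup.m_closed[OF H(1) that] by simp
  have Hneg: "\<ominus> x \<in> H" if "x \<in> H" for x
    using subgroup.m_inv_closed[OF H(1) that] by (simp add: a_inv_def)
  have Hmul: "[i] \<cdot> x \<in> H" if "x \<in> H" for x and i :: int
    using add.subgroup_int_pow_closed[OF H(1) that] .
  have cover: "\<exists>r::int. x \<ominus> [r] \<cdot> \<one> \<in> H" if x: "x \<in> carrier R" for x
  proof (cases "x \<in> H")
    case True
    then show ?thesis using x by (intro exI[of _ 0]) (simp add: a_minus_def add_pow_def)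
  next
    case False
    \<comment> \<open>\<open>K\<close> is generated by \<open>H\<close> and \<open>x\<close>, hence
      contains 1 by maximality of \<open>H\<close>. The coefficient of \<open>x\<close> in 1 is
      invertible modulo \<open>p\<close>, since otherwise 1 would lie in \<open>H\<close>; solving
      for \<open>x\<close> gives \<open>r\<close>.\<close>
    define K where "K = {h \<oplus> [i] \<cdot> x | h i. h \<in> H \<and> (i::int) \<in> UNIV}"
    have "subgroup K (add_monoid R)"
    proof (rule add.subgroupI)
      show "K \<subseteq> carrier R" using Hc x by (auto simp: K_def)
      show "K \<noteq> {}" using H0 by (auto simp: K_def)
      show "\<ominus> k \<in> K" if k: "k \<in> K" for k
      proof -
        obtain h and i :: int where hi: "h \<in> H" "k = h \<oplus> [i] \<cdot> x" using k by (auto simp: K_def)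
        then have "\<ominus> k = \<ominus> h \<oplus> [(- i)] \<cdot> x"
          using Hc x by (auto simp: minus_add add.int_pow_neg)
        then show ?thesis using Hneg[OF hi(1)] by (auto simp: K_def)
      qed
      show "k \<oplus> l \<in> K" if k: "k \<in> K" "l \<in> K" for k l
      proof -
        obtain h h' and i i' :: int where hi: "h \<in> H" "k = h \<oplus> [i] \<cdot> x" "h' \<in> H" "l = h' \<oplus> [(i')] \<cdot> x"
          using k by (auto simp: K_def)
        then have "h \<in> carrier R" "h' \<in> carrier R" using Hc by auto
        then have "k \<oplus> l = (h \<oplus> h') \<oplus> [(i + i')] \<cdot> x"
          using hi x by (simp add: add.int_pow_mult a_ac)
        then show ?thesis using Hadd[OF hi(1,3)] by (auto simp: K_def)
      qed
    qed
    moreover have "H \<subseteq> K"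
    proof
      fix h assume "h \<in> H"
      then have "h = h \<oplus> [(0::int)] \<cdot> x" using Hc by (auto simp: add_pow_def)
      then show "h \<in> K" using \<open>h \<in> H\<close> by (auto simp: K_def)
    qed
    moreover have "x \<in> K"
    proof -
      have "x = \<zero> \<oplus> [(1::int)] \<cdot> x" using x by (simp add: add.int_pow_1)
      then show ?thesis using H0 by (auto simp: K_def)
    qed
    ultimately have "\<one> \<in> K" using max[of K] False by (auto simp: Hs_def)
    then obtain h and i :: int where hi: "h \<in> H" "\<one> = h \<oplus> [i] \<cdot> x" by (auto simp: K_def)
    have h: "h \<in> carrier R" using hi Hc by auto
    have "\<not> int p dvd i"
    proof
      assume "int p dvd i"
      then have "\<one> = h" using char[OF x] hi(2) h by simp
      then show False using H(2) hi(1) by simp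
    qed
    then obtain j where j: "[i * j = 1] (mod int p)" using inverse by blast
    have "[j] \<cdot> \<one> = [j] \<cdot> (h \<oplus> [i] \<cdot> x)" using hi(2) by simp
    also have "\<dots> = [j] \<cdot> h \<oplus> [(i * j)] \<cdot> x"
      using h x by (simp add: add.int_pow_distrib add.int_pow_pow)
    also have "\<dots> = [j] \<cdot> h \<oplus> x" using scale[OF x j] by simp
    finally have "x \<ominus> [j] \<cdot> \<one> = \<ominus> ([j] \<cdot> h)"
      using h x by (simp add: a_minus_def minus_add a_ac r_neg r_neg2)
    then show ?thesis using Hneg[OF Hmul[OF hi(1)]] by metis
  qed
  \<comment> \<open>Two representatives put the multiple of 1 by \<open>r - s\<close> into
    \<open>H\<close>; if \<open>r - s\<close> were invertible modulo \<open>p\<close>, then 1 itself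
    would lie in \<open>H\<close>.\<close>
  have unique: "[r = s] (mod int p)"
    if x: "x \<in> carrier R" and rs: "x \<ominus> [r] \<cdot> \<one> \<in> H" "x \<ominus> [s] \<cdot> \<one> \<in> H" for x and r s :: int
  proof (rule ccontr)
    assume "\<not> [r = s] (mod int p)"
    then have "\<not> int p dvd r - s" by (simp add: cong_iff_dvd_diff)
    then obtain j where j: "[(r - s) * j = 1] (mod int p)" using inverse by blast
    have "(x \<ominus> [s] \<cdot> \<one>) \<oplus> \<ominus> (x \<ominus> [r] \<cdot> \<one>) = [r] \<cdot> \<one> \<oplus> \<ominus> ([s] \<cdot> \<one>)"
      using x by (simp add: a_minus_def minus_add a_ac r_neg2)
    also have "\<dots> = [(r - s)] \<cdot> \<one>" by (simp add: add.int_pow_diff)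
    finally have "[(r - s)] \<cdot> \<one> \<in> H" using Hadd[OF rs(2) Hneg[OF rs(1)]] by simp
    then have "[((r - s) * j)] \<cdot> \<one> \<in> H" using Hmul[of "[(r - s)] \<cdot> \<one>" j] by (simp add: add.int_pow_pow)
    then show False using scale[OF one_closed j] H(2) by simp
  qed
  define f where "f x = (SOME r::int. x \<ominus> [r] \<cdot> \<one> \<in> H)" for x
  have f: "x \<ominus> [f x] \<cdot> \<one> \<in> H" if "x \<in> carrier R" for x
    unfolding f_def by (rule someI_ex) (rule cover[OF that])
  have "additive_mod R p f"
    unfolding additive_mod_def
  proof (intro ballI)
    fix x y assume xy: "x \<in> carrier R" "y \<in> carrier R"
    have "(x \<ominus> [f x] \<cdot> \<one>) \<oplus> (y \<ominus> [f y] \<cdot> \<one>) = (x \<oplus> y) \<ominus> [(f x + f y)] \<cdot> \<one>"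
      using xy by (simp add: a_minus_def minus_add a_ac add.int_pow_mult)
    then have "(x \<oplus> y) \<ominus> [(f x + f y)] \<cdot> \<one> \<in> H" using Hadd[OF f f] xy by metis
    then show "[f (x \<oplus> y) = f x + f y] (mod int p)"
      using unique[of "x \<oplus> y"] f xy by simp
  qed
  moreover have "\<one> \<ominus> [(1::int)] \<cdot> \<one> \<in> H"
    using H0 by (simp add: add.int_pow_1 a_minus_def r_neg)
  then have "[f \<one> = 1] (mod int p)" using unique[of \<one>] f[of \<one>] by simp
  ultimately show thesis using that by blast
qed

end

lemma fermat_theorem_int:
  assumes "prime p" "\<not> int p dvd x"
  shows "[x ^ (p - 1) = 1] (mod int p)"
proof -
  have p0: "p > 0" using \<open>prime p\<close> prime_gt_0_nat by blast
  define a where "a = nat (x mod int p)"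
  have a: "int a = x mod int p" using p0 by (simp add: a_def)
  then have "\<not> p dvd a" using assms(2) by (metis dvd_mod_iff dvd_refl int_dvd_int_iff)
  then have "[int (a ^ (p - 1)) = int 1] (mod int p)"
    using fermat_theorem[OF \<open>prime p\<close>] by (simp only: cong_int_iff)
  moreover have "[x ^ (p - 1) = int a ^ (p - 1)] (mod int p)"
    by (intro cong_pow) (simp add: a cong_def)
  ultimately show ?thesis by (simp add: cong_trans)
qed

section \<open>Transfer of parity conditions from the field to the residues\<close>

context field
begin

lemma odd_card_additive_mod_fibre:
  assumes fin: "finite (carrier R)" and p: "prime p" "p \<noteq> 2"
    and f: "additive_mod R p f" "[f \<one> = 1] (mod int p)"
  shows "odd (card {a \<in> carrier R. [f a = 1] (mod int p)})"
proof -
  let ?A = "{a \<in> carrier R. [f a = 1] (mod int p)}"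
  (* The involution g of the fibre fixes only 1. *)
  define g where "g a = (\<one> \<oplus> \<one>) \<ominus> a" for a
  have two: "[f (\<one> \<oplus> \<one>) = 1 + 1] (mod int p)"
    using additive_modD[OF f(1), of \<one> \<one>] cong_add[OF f(2) f(2)] by (simp add: cong_trans)
  have "odd p" using p prime_odd_nat[of p] prime_ge_2_nat[of p] by fastforce
  \<comment> \<open>Detected by \<open>f\<close>, whose value at
    \<open>\<one> \<oplus> \<one>\<close> is 2 modulo the odd prime \<open>p\<close>.\<close>
  have nz: "\<one> \<oplus> \<one> \<noteq> \<zero>"
  proof
    assume "\<one> \<oplus> \<one> = \<zero>"
    then have "[2 = 0] (mod int p)"
      using two additive_mod_zero[OF f(1)] by (metis cong_sym cong_trans one_add_one)
    then have "p dvd 2" by (simp add: cong_0_iff flip: int_dvd_int_iff)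
    then show False using \<open>odd p\<close> p(1) by (metis primes_dvd_imp_eq two_is_prime_nat p(2))
  qed
  have "[card ?A = card {a \<in> ?A. g a = a}] (mod 2)"
  proof (rule cong_card_fixpoints)
    fix a assume a: "a \<in> ?A"
    have "[f (g a) = f (\<one> \<oplus> \<one>) - f a] (mod int p)"
      unfolding g_def using a by (intro additive_mod_minus[OF f(1)]) auto
    also have "[f (\<one> \<oplus> \<one>) - f a = (1 + 1) - 1] (mod int p)"
      using a two by (intro cong_diff) auto
    finally show "g a \<in> ?A" using a by (simp add: g_def)
    show "(g ^^ 2) a = a"
      using a by (simp add: g_def numeral_2_eq_2 a_minus_def minus_add a_ac r_neg2)
        (simp add: r_neg2 a_assoc[symmetric] r_neg)
  qed (use fin in auto)
  moreover have "{a \<in> ?A. g a = a} = {\<one>}"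
  proof (intro equalityI subsetI)
    fix a assume "a \<in> {a \<in> ?A. g a = a}"
    then have a: "a \<in> carrier R" "(\<one> \<oplus> \<one>) \<ominus> a = a" by (auto simp: g_def)
    have "(\<one> \<oplus> \<one>) \<otimes> (a \<ominus> \<one>) = (a \<oplus> a) \<ominus> (\<one> \<oplus> \<one>)"
      using a(1) by (simp add: a_minus_def minus_add a_ac l_distr r_distr r_minus)
    also have "a \<oplus> a = ((\<one> \<oplus> \<one>) \<ominus> a) \<oplus> a" using a by simp
    also have "\<dots> = \<one> \<oplus> \<one>" using a(1) by (simp add: a_minus_def a_assoc l_neg)
    finally have "(\<one> \<oplus> \<one>) \<otimes> (a \<ominus> \<one>) = \<zero>" by (simp add: a_minus_def r_neg)
    then have "a \<ominus> \<one> = \<zero>" using integral[of "\<one> \<oplus> \<one>" "a \<ominus> \<one>"] nz a(1) by auto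
    then show "a \<in> {\<one>}" using a(1) by simp
  next
    fix a assume "a \<in> {\<one>}"
    then show "a \<in> {a \<in> ?A. g a = a}"
      using f(2) by (auto simp: g_def a_minus_def a_assoc r_neg)
  qed
  ultimately show ?thesis by (simp add: cong_def odd_iff_mod_2_eq_one)
qed

text \<open>Ensures that the image of \<open>S\<close>, counted modulo 2, is not empty. A functional
  fixed in advance may have only even fibres on a set of even size; it is then composed with a
  suitable multiplication.\<close>

lemma exists_odd_fibre:
  assumes fin: "finite (carrier R)" and p: "prime p" "p \<noteq> 2"
    and char: "\<And>x i. x \<in> carrier R \<Longrightarrow> int p dvd i \<Longrightarrow> [i] \<cdot> x = \<zero>"
    and S: "S \<subseteq> carrier R" "S \<noteq> {}"
  obtains f c where "additive_mod R p f" "odd (card {x \<in> S. [f x = c] (mod int p)})"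
proof -
  obtain f where f: "additive_mod R p f" "[f \<one> = 1] (mod int p)"
    using exists_additive_mod[OF fin p(1) char] by blast
  have "finite S" using fin S finite_subset by blast
  show thesis
  proof (cases "even (card S)")
    case False
    \<comment> \<open>The fibres of \<open>f\<close> partition a set of odd size, so one of them is
      odd.\<close>
    have "\<exists>c. odd (card {x \<in> S. [f x = c] (mod int p)})"
    proof (rule ccontr)
      assume no: "\<not> ?thesis"
      have "even (card {x \<in> S. f x mod int p = v})" for v
      proof (cases "v mod int p = v")
        case True
        then have "{x \<in> S. f x mod int p = v} = {x \<in> S. [f x = v] (mod int p)}"
          by (auto simp: cong_def)
        then show ?thesis using no by simp
      next
        case False
        then have "{x \<in> S. f x mod int p = v} = {}" by auto
        then show ?thesis by (metis card.empty even_zero)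
      qed
      then have "even (card {x \<in> S. True})"
        using even_card_fibres[OF \<open>finite S\<close>, of "\<lambda>_. True" "\<lambda>x. f x mod int p"] by simp
      then show False using False by simp
    qed
    then show thesis using that f(1) by blast
  next
    case True
    obtain x0 where x0: "x0 \<in> S" using S by blast
    (* The maps x |-> f (a (x - x0)) all vanish at x0 but take the value 1 at any other point for an
       odd number of a; hence some a gives an odd fibre over 1. *)
    define Q where "Q a x \<longleftrightarrow> [f (a \<otimes> (x \<ominus> x0)) = 1] (mod int p)" for a x
    have count: "odd (card {a \<in> carrier R. Q a x}) \<longleftrightarrow> x \<noteq> x0" if "x \<in> S" for x
    proof (cases "x = x0")
      case True
      have "x0 \<ominus> x0 = \<zero>" using x0 S by (auto simp: a_minus_def r_neg)
      moreover have "\<not> [f \<zero> = 1] (mod int p)"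
      proof
        assume "[f \<zero> = 1] (mod int p)"
        then have "[1 = 0] (mod int p)"
          using additive_mod_zero[OF f(1)] by (metis cong_sym cong_trans)
        then show False using prime_gt_1_nat[OF p(1)] by (simp add: cong_def)
      qed
      ultimately have "{a \<in> carrier R. Q a x} = {}" using True by (auto simp: Q_def)
      then show ?thesis using True by (metis card.empty even_zero)
    next
      case False
      define w where "w = x \<ominus> x0"
      have "x \<in> carrier R" "x0 \<in> carrier R" using that x0 S by auto
      then have w: "w \<in> carrier R" "w \<noteq> \<zero>" using False by (simp_all add: w_def)
      then have wu: "w \<in> Units R" by (simp add: field_Units)
      \<comment> \<open>Multiplication by the nonzero \<open>w\<close> carries the multipliers in
        question onto the fibre of \<open>f\<close> over 1, whose size is odd.\<close>
      have "bij_betw (\<lambda>a. a \<otimes> w) {a \<in> carrier R. Q a x} {b \<in> carrier R. [f b = 1] (mod int p)}"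
        by (rule bij_betw_byWitness[where f' = "\<lambda>b. b \<otimes> inv w"])
          (use w wu in \<open>auto simp: Q_def w_def[symmetric] m_assoc\<close>)
      then have "card {a \<in> carrier R. Q a x} = card {b \<in> carrier R. [f b = 1] (mod int p)}"
        by (rule bij_betw_same_card)
      then show ?thesis using odd_card_additive_mod_fibre[OF fin p f] False by simp
    qed
    have "(\<Sum>a\<in>carrier R. card {x \<in> S. Q a x}) = (\<Sum>x\<in>S. card {a \<in> carrier R. Q a x})"
      by (rule sum_card_swap[OF fin \<open>finite S\<close>])
    \<comment> \<open>Modulo 2 every point except \<open>x0\<close> contributes 1, and
      \<open>S - {x0}\<close> has odd size because \<open>S\<close> has even size.\<close>
    moreover have "odd (\<Sum>x\<in>S. card {a \<in> carrier R. Q a x})"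
    proof -
      have "{x \<in> S. odd (card {a \<in> carrier R. Q a x})} = S - {x0}"
        using count by blast
      moreover have "odd (card (S - {x0}))"
        using True x0 \<open>finite S\<close> card_Suc_Diff1[OF \<open>finite S\<close> x0] by (metis even_Suc)
      ultimately show ?thesis using \<open>finite S\<close> by (simp add: even_sum_iff)
    qed
    ultimately have "odd (\<Sum>a\<in>carrier R. card {x \<in> S. Q a x})" by simp
    then obtain a where a: "a \<in> carrier R" "odd (card {x \<in> S. Q a x})"
      using dvd_sum[of "carrier R" 2 "\<lambda>a. card {x \<in> S. Q a x}"] by blast
    define f' where "f' x = f (a \<otimes> x)" for x
    have f': "additive_mod R p f'"
      unfolding f'_def by (rule additive_mod_mult[OF f(1) a(1)])
    \<comment> \<open>By additivity the translation by \<open>x0\<close> only moves the fibre of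
      \<open>f'\<close> from 1 to \<open>1 + f' x0\<close>.\<close>
    have "Q a x \<longleftrightarrow> [f' x = 1 + f' x0] (mod int p)" if "x \<in> S" for x
    proof -
      have "[f' (x \<ominus> x0) = f' x - f' x0] (mod int p)"
        using that x0 S by (intro additive_mod_minus[OF f']) auto
      then have "Q a x \<longleftrightarrow> [f' x - f' x0 = 1] (mod int p)"
        unfolding Q_def f'_def[symmetric] by (meson cong_sym cong_trans)
      then show ?thesis by (simp add: cong_iff_dvd_diff algebra_simps)
    qed
    then have "{x \<in> S. Q a x} = {x \<in> S. [f' x = 1 + f' x0] (mod int p)}" by blast
    then show thesis using that[OF f'] a(2) by metis
  qed
qed

text \<open>Excludes characteristic 2. In the group algebra of the additive group modulo 2, the sum
  of the elements of \<open>T\<close> has square \<open>card T\<close>, which is 1; so it is a unit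
  and annihilates only the empty \<open>S\<^sub>0\<close>.\<close>

lemma even_translates_char_two:
  assumes fin: "finite (carrier R)" and two: "\<And>x. x \<in> carrier R \<Longrightarrow> x \<oplus> x = \<zero>"
    and S: "S\<^sub>0 \<subseteq> carrier R" "T \<subseteq> carrier R" "odd (card T)"
    and even: "\<And>\<alpha>. \<alpha> \<in> carrier R \<Longrightarrow> even (card {s \<in> T. \<alpha> \<oplus> s \<in> S\<^sub>0})"
  shows "S\<^sub>0 = {}"
proof (rule ccontr)
  assume "S\<^sub>0 \<noteq> {}"
  then obtain x where x: "x \<in> S\<^sub>0" "x \<in> carrier R" using S by blast
  (* Swapping the two summands pairs off the elements of P outside the diagonal, and on the diagonal
     the two equal summands cancel. *)
  define P where "P = Sigma T (\<lambda>s. {s' \<in> T. (x \<oplus> s) \<oplus> s' \<in> S\<^sub>0})"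
  have "finite T" using S fin finite_subset by blast
  have "card P = (\<Sum>s\<in>T. card {s' \<in> T. (x \<oplus> s) \<oplus> s' \<in> S\<^sub>0})"
    unfolding P_def using \<open>finite T\<close> by (intro card_SigmaI) auto
  also have "even \<dots>"
    using S x by (intro dvd_sum even) auto
  finally have "even (card P)" .
  moreover have "[card P = card {q \<in> P. prod.swap q = q}] (mod 2)"
  proof (rule cong_card_fixpoints)
    show "finite P" using \<open>finite T\<close> by (auto simp: P_def)
    fix q assume q: "q \<in> P"
    then obtain s s' where ss: "q = (s, s')" "s \<in> T" "s' \<in> T" "(x \<oplus> s) \<oplus> s' \<in> S\<^sub>0"
      by (auto simp: P_def)
    then have "s \<in> carrier R" "s' \<in> carrier R" using S by auto
    then have "(x \<oplus> s') \<oplus> s = (x \<oplus> s) \<oplus> s'" using x by (simp add: a_ac)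
    then show "prod.swap q \<in> P" using ss by (simp add: P_def)
    show "(prod.swap ^^ 2) q = q" by (simp add: numeral_2_eq_2)
  qed auto
  moreover have "{q \<in> P. prod.swap q = q} = (\<lambda>s. (s, s)) ` T"
  proof -
    have "(x \<oplus> s) \<oplus> s \<in> S\<^sub>0" if "s \<in> T" for s
      using that S x two[of s] by (auto simp: a_assoc)
    then have diag: "(s, s) \<in> P" if "s \<in> T" for s using that by (simp add: P_def)
    show ?thesis
    proof (intro equalityI subsetI)
      fix q assume q: "q \<in> {q \<in> P. prod.swap q = q}"
      then have "q \<in> P" "prod.swap q = q" by blast+
      then have "snd q = fst q" by (metis fst_swap)
      moreover have "fst q \<in> T" using \<open>q \<in> P\<close> by (auto simp: P_def)
      moreover have "q = (fst q, snd q)" by simp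
      ultimately show "q \<in> (\<lambda>s. (s, s)) ` T" by (intro image_eqI[of _ _ "fst q"]) simp_all
    next
      fix q assume "q \<in> (\<lambda>s. (s, s)) ` T"
      then obtain s where "q = (s, s)" "s \<in> T" by blast
      then show "q \<in> {q \<in> P. prod.swap q = q}" using diag by simp
    qed
  qed
  then have "card {q \<in> P. prod.swap q = q} = card T"
    by (simp add: card_image inj_on_def)
  ultimately show False using S(3) by (simp add: cong_def even_iff_mod_2_eq_zero)
qed

text \<open>The fibre over \<open>y + f (h s)\<close> in \<open>S\<^sub>0\<close> is the translate
  by \<open>h s\<close> of those \<alpha> in the fibre over \<open>y\<close> with
  \<open>\<alpha> \<oplus> h s \<in> S\<^sub>0\<close>. Summed over \<open>s\<close> and counted by
  \<alpha> instead, each \<alpha> contributes an even number; and a sum of counts is even exactly if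
  evenly many of them are odd.\<close>

lemma even_translates_pushforward:
  assumes fin: "finite (carrier R)" and f: "additive_mod R p f"
    and S: "S\<^sub>0 \<subseteq> carrier R" "T \<subseteq> carrier R"
    and even: "\<And>\<alpha>. \<alpha> \<in> carrier R \<Longrightarrow> even (card {s \<in> T. \<alpha> \<oplus> h s \<in> S\<^sub>0})"
    and h: "\<And>s. s \<in> T \<Longrightarrow> h s \<in> carrier R"
  shows "even (card {s \<in> T. odd (card {x \<in> S\<^sub>0. [f x = y + f (h s)] (mod int p)})})"
proof -
  have "finite T" using S fin finite_subset by blast
  have "card {x \<in> S\<^sub>0. [f x = y + f (h s)] (mod int p)} =
      card {\<alpha> \<in> carrier R. [f \<alpha> = y] (mod int p) \<and> \<alpha> \<oplus> h s \<in> S\<^sub>0}" if s: "s \<in> T" for s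
  proof -
    have hs: "h s \<in> carrier R" using h s by blast
    have iff: "[f (\<alpha> \<oplus> h s) = y + f (h s)] (mod int p) \<longleftrightarrow> [f \<alpha> = y] (mod int p)"
      if "\<alpha> \<in> carrier R" for \<alpha>
      using additive_modD[OF f that hs] by (metis cong_add_rcancel cong_sym cong_trans)
    have "bij_betw (\<lambda>\<alpha>. \<alpha> \<oplus> h s)
        {\<alpha> \<in> carrier R. [f \<alpha> = y] (mod int p) \<and> \<alpha> \<oplus> h s \<in> S\<^sub>0}
        {x \<in> S\<^sub>0. [f x = y + f (h s)] (mod int p)}"
    proof (rule bij_betw_byWitness[where f' = "\<lambda>x. x \<ominus> h s"])
      have inv: "(x \<ominus> h s) \<oplus> h s = x" if "x \<in> carrier R" for x
        using that hs by (simp add: a_minus_def a_assoc l_neg)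
      show "\<forall>\<alpha>\<in>{\<alpha> \<in> carrier R. [f \<alpha> = y] (mod int p) \<and> \<alpha> \<oplus> h s \<in> S\<^sub>0}. (\<alpha> \<oplus> h s) \<ominus> h s = \<alpha>"
        using hs by (simp add: a_minus_def a_assoc r_neg)
      show "\<forall>x\<in>{x \<in> S\<^sub>0. [f x = y + f (h s)] (mod int p)}. (x \<ominus> h s) \<oplus> h s = x"
        using inv S by blast
      show "(\<lambda>\<alpha>. \<alpha> \<oplus> h s) ` {\<alpha> \<in> carrier R. [f \<alpha> = y] (mod int p) \<and> \<alpha> \<oplus> h s \<in> S\<^sub>0}
          \<subseteq> {x \<in> S\<^sub>0. [f x = y + f (h s)] (mod int p)}"
        using iff by auto
      show "(\<lambda>x. x \<ominus> h s) ` {x \<in> S\<^sub>0. [f x = y + f (h s)] (mod int p)}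
          \<subseteq> {\<alpha> \<in> carrier R. [f \<alpha> = y] (mod int p) \<and> \<alpha> \<oplus> h s \<in> S\<^sub>0}"
      proof clarify
        fix x assume x: "x \<in> S\<^sub>0" "[f x = y + f (h s)] (mod int p)"
        then have "x \<in> carrier R" using S by blast
        then show "x \<ominus> h s \<in> carrier R \<and> [f (x \<ominus> h s) = y] (mod int p) \<and> (x \<ominus> h s) \<oplus> h s \<in> S\<^sub>0"
          using iff[of "x \<ominus> h s"] inv[of x] x hs by simp
      qed
    qed
    then show ?thesis by (simp add: bij_betw_same_card)
  qed
  then have "(\<Sum>s\<in>T. card {x \<in> S\<^sub>0. [f x = y + f (h s)] (mod int p)}) =
      (\<Sum>s\<in>T. card {\<alpha> \<in> carrier R. [f \<alpha> = y] (mod int p) \<and> \<alpha> \<oplus> h s \<in> S\<^sub>0})"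
    by (intro sum.cong) auto
  also have "\<dots> = (\<Sum>\<alpha>\<in>carrier R. card {s \<in> T. [f \<alpha> = y] (mod int p) \<and> \<alpha> \<oplus> h s \<in> S\<^sub>0})"
    by (rule sum_card_swap[OF \<open>finite T\<close> fin])
  also have "even \<dots>"
  proof (rule dvd_sum)
    fix \<alpha> assume "\<alpha> \<in> carrier R"
    then show "even (card {s \<in> T. [f \<alpha> = y] (mod int p) \<and> \<alpha> \<oplus> h s \<in> S\<^sub>0})"
      using even[of \<alpha>] by (cases "[f \<alpha> = y] (mod int p)") simp_all
  qed
  finally show ?thesis using \<open>finite T\<close> by (simp add: even_sum_iff)
qed

section \<open>Matching vectors and their growth exponent\<close>

text \<open>Fermat's theorem turns \<open>M\<close> into the identity matrix modulo
  \<open>p\<close>. Its rank bound is polynomial in \<open>m\<close> of degree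
  \<open>(p - 1) * card T\<close>; the size of the field enters only as a constant factor of
  \<open>m\<close>.\<close>

lemma matching_vectors_bound:
  assumes fin: "finite (carrier R)" and p: "prime p" and f: "additive_mod R p f"
    and T: "T \<subseteq> carrier R"
    and sep: "\<And>\<beta>. \<beta> \<in> S \<Longrightarrow> \<exists>s\<in>T. \<not> [f (\<beta> \<otimes> s) = 0] (mod int p)"
    and uv: "\<And>i. i \<in> {1..n} \<Longrightarrow> u i \<in> vecs R m" "\<And>i. i \<in> {1..n} \<Longrightarrow> v i \<in> vecs R m"
    and diag: "\<And>i. i \<in> {1..n} \<Longrightarrow> dot R m (u i) (v i) = \<zero>"
    and off: "\<And>i j. i \<in> {1..n} \<Longrightarrow> j \<in> {1..n} \<Longrightarrow> i \<noteq> j \<Longrightarrow> dot R m (u j) (v i) \<in> S"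
  shows "n \<le> (1 + (m * card (carrier R)) ^ (p - 1)) ^ card T"
proof -
  (* G s j i = f ((u_j, v_i) s) modulo p; summing over all values z of the coordinate of u_j exhibits
     the rank. *)
  define G where "G s j i =
    (\<Sum>l\<in>{1..m}. \<Sum>z\<in>carrier R. of_bool (u j l = z) * f ((z \<otimes> v i l) \<otimes> s))" for s j i
  define M where "M j i = (\<Prod>s\<in>T. 1 - G s j i ^ (p - 1))" for j i
  have "finite T" using T fin finite_subset by blast
  have p1: "p > 1" using p prime_gt_1_nat by blast
  have rank: "separable_rank (m * (card (carrier R) * 1)) (G s)" for s
  proof -
    have "separable_rank (card (carrier R) * 1)
        (\<lambda>j i. \<Sum>z\<in>carrier R. of_bool (u j l = z) * f ((z \<otimes> v i l) \<otimes> s))" for l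
      by (intro separable_rank_sum fin separable_rank_product)
    then show ?thesis
      using separable_rank_sum[of "{1..m}"] unfolding G_def by fastforce
  qed
  then have "separable_rank (1 + (m * card (carrier R)) ^ (p - 1)) (\<lambda>j i. 1 - G s j i ^ (p - 1))" for s
    using separable_rank_diff[OF separable_rank_power[OF rank[of s], of "p - 1"] separable_rank_const[of 1]]
    by simp
  then have rank_M: "separable_rank ((1 + (m * card (carrier R)) ^ (p - 1)) ^ card T) M"
    unfolding M_def by (intro separable_rank_prod \<open>finite T\<close>)
  have "[M j i = of_bool (i = j)] (mod int p)" if ij: "i \<in> {1..n}" "j \<in> {1..n}" for i j
  proof -
    have ujl: "u j l \<in> carrier R" "v i l \<in> carrier R" if "l \<in> {1..m}" for l
      using uv(1)[OF ij(2)] uv(2)[OF ij(1)] that by (auto simp: vecs_def)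
    have G: "[G s j i = f (dot R m (u j) (v i) \<otimes> s)] (mod int p)" if "s \<in> T" for s
    proof -
      have s: "s \<in> carrier R" using that T by blast
      have "(\<Sum>z\<in>carrier R. of_bool (u j l = z) * f ((z \<otimes> v i l) \<otimes> s)) =
          f ((u j l \<otimes> v i l) \<otimes> s)" if "l \<in> {1..m}" for l
      proof -
        have "(\<Sum>z\<in>carrier R. of_bool (u j l = z) * f ((z \<otimes> v i l) \<otimes> s)) =
            (\<Sum>z\<in>carrier R. if u j l = z then f ((z \<otimes> v i l) \<otimes> s) else 0)"
          by (intro sum.cong) auto
        then show ?thesis using fin ujl[OF that] by simp
      qed
      then have "G s j i = (\<Sum>l\<in>{1..m}. f ((u j l \<otimes> v i l) \<otimes> s))"
        unfolding G_def by (intro sum.cong) auto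
      moreover have "dot R m (u j) (v i) \<otimes> s = (\<Oplus>l\<in>{1..m}. (u j l \<otimes> v i l) \<otimes> s)"
        unfolding dot_def using ujl s by (intro finsum_ldistr) auto
      moreover have "[f (\<Oplus>l\<in>{1..m}. (u j l \<otimes> v i l) \<otimes> s) =
          (\<Sum>l\<in>{1..m}. f ((u j l \<otimes> v i l) \<otimes> s))] (mod int p)"
        using ujl s by (intro additive_mod_finsum[OF f]) auto
      ultimately show ?thesis by (simp add: cong_sym)
    qed
    show ?thesis
    proof (cases "i = j")
      case True
      have "[1 - G s j i ^ (p - 1) = 1 - 0 ^ (p - 1)] (mod int p)" if "s \<in> T" for s
      proof -
        have "dot R m (u j) (v i) \<otimes> s = \<zero>"
          using diag[OF ij(1)] True that T by auto
        then have "[G s j i = 0] (mod int p)"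
          using G[OF that] additive_mod_zero[OF f] by (metis cong_trans)
        then show ?thesis by (intro cong_diff cong_pow cong_refl)
      qed
      then have "[M j i = (\<Prod>s\<in>T. 1 - 0 ^ (p - 1))] (mod int p)"
        unfolding M_def by (intro cong_prod)
      moreover have "(\<Prod>s\<in>T. 1 - 0 ^ (p - 1)) = (1::int)" using p1 by (simp add: power_0_left)
      ultimately have "[M j i = 1] (mod int p)" by metis
      then show ?thesis using True by simp
    next
      case False
      then obtain s where s: "s \<in> T" "\<not> [f (dot R m (u j) (v i) \<otimes> s) = 0] (mod int p)"
        using sep[OF off[OF ij]] by blast
      then have "\<not> [G s j i = 0] (mod int p)" using G[OF s(1)] by (metis cong_sym cong_trans)
      then have "[G s j i ^ (p - 1) = 1] (mod int p)"
        by (intro fermat_theorem_int p) (simp add: cong_0_iff)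
      then have "int p dvd 1 - G s j i ^ (p - 1)"
        by (simp add: cong_iff_dvd_diff dvd_diff_commute)
      then have "int p dvd M j i"
        unfolding M_def using dvd_prodI[OF \<open>finite T\<close> s(1)] by (rule dvd_trans)
      then show ?thesis using False by (simp add: cong_0_iff)
    qed
  qed
  then have "card {1..n} \<le> (1 + (m * card (carrier R)) ^ (p - 1)) ^ card T"
    by (rule identity_separable_rank[OF rank_M p1 finite_atLeastAtMost])
  then show ?thesis by simp
qed

end

text \<open>If \<open>t\<close> exceeded the degree \<open>a * b\<close>, it would by integrality
  exceed it by at least 1, and dividing by \<open>m ^ (a * b)\<close> would bound
  \<open>c * m\<close> for all \<open>m\<close>.\<close>

lemma powr_growth_exponent_bound:
  fixes t :: int and c :: real
  assumes "c > 0" "q > 0"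
    and bound: "\<And>m. m > 0 \<Longrightarrow> nat \<lfloor>c * real m powr real_of_int t\<rfloor> \<le> (1 + (m * q) ^ a) ^ b"
  shows "t \<le> int (a * b)"
proof (rule ccontr)
  assume "\<not> t \<le> int (a * b)"
  then have "real_of_int (int (a * b) + 1) \<le> real_of_int t" by (simp only: of_int_le_iff)
  then have t: "real (a * b) + 1 \<le> real_of_int t" by simp
  \<comment> \<open>As \<open>m * q \<ge> 1\<close>, doubling absorbs the summand 1, and
    \<open>C\<close> collects what does not depend on \<open>m\<close>. The 1 in
    \<open>C + 1\<close> below pays for the floor.\<close>
  define C :: real where "C = real ((2 * q ^ a) ^ b)"
  have le: "c * real m \<le> C + 1" if "m > 0" for m
  proof -
    have m1: "real m \<ge> 1" using that by simp
    have "(m * q) ^ a \<ge> 1" using that \<open>q > 0\<close> by simp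
    then have "1 + (m * q) ^ a \<le> 2 * (m * q) ^ a" by linarith
    then have "(1 + (m * q) ^ a) ^ b \<le> (2 * (m * q) ^ a) ^ b" by (intro power_mono) auto
    also have "\<dots> = (2 * q ^ a) ^ b * m ^ (a * b)"
      by (simp add: power_mult_distrib power_mult mult_ac)
    finally have "nat \<lfloor>c * real m powr real_of_int t\<rfloor> \<le> (2 * q ^ a) ^ b * m ^ (a * b)"
      using bound[OF that] by simp
    then have "real (nat \<lfloor>c * real m powr real_of_int t\<rfloor>) \<le> real ((2 * q ^ a) ^ b * m ^ (a * b))"
      by (simp only: of_nat_le_iff)
    then have "real (nat \<lfloor>c * real m powr real_of_int t\<rfloor>) \<le> C * real m ^ (a * b)"
      by (simp add: C_def)
    then have "c * real m powr real_of_int t \<le> C * real m ^ (a * b) + 1" by linarith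
    moreover have "c * (real m ^ (a * b) * real m) \<le> c * real m powr real_of_int t"
    proof -
      have "real m ^ (a * b) * real m = real m powr (real (a * b) + 1)"
        using that by (simp add: powr_add powr_realpow del: of_nat_mult)
      also have "\<dots> \<le> real m powr real_of_int t" using t m1 by (intro powr_mono) auto
      finally show ?thesis using \<open>c > 0\<close> by simp
    qed
    moreover have "1 \<le> real m ^ (a * b)" using m1 by simp
    ultimately have "(c * real m) * real m ^ (a * b) \<le> (C + 1) * real m ^ (a * b)"
      by (simp add: algebra_simps)
    then show ?thesis
      by (rule mult_right_le_imp_le) (use \<open>1 \<le> real m ^ (a * b)\<close> in linarith)
  qed
  obtain m where "(C + 1) / c < real m" using reals_Archimedean2 by blast
  then have "C + 1 < c * real m" using \<open>c > 0\<close> by (simp add: field_simps)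
  moreover have "C \<ge> 0" by (simp add: C_def)
  ultimately have "m > 0" by (cases m) simp_all
  then show False using le[of m] \<open>C + 1 < c * real m\<close> by linarith
qed

section \<open>Consequences of the two niceness conditions\<close>

lemma combinatorially_niceE:
  assumes "combinatorially_nice R t S"
  obtains c where "c > 0" "\<forall>m>0. \<exists>u v.
    (\<forall>i\<in>{1..nat \<lfloor>c * real m powr t\<rfloor>}. u i \<in> vecs R m \<and> v i \<in> vecs R m) \<and>
    (\<forall>i\<in>{1..nat \<lfloor>c * real m powr t\<rfloor>}. dot R m (u i) (v i) = \<zero>\<^bsub>R\<^esub>) \<and>
    (\<forall>i\<in>{1..nat \<lfloor>c * real m powr t\<rfloor>}. \<forall>j\<in>{1..nat \<lfloor>c * real m powr t\<rfloor>}.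
      i \<noteq> j \<longrightarrow> dot R m (u j) (v i) \<in> S)"
  using assms unfolding combinatorially_nice_def Let_def
  by (elim conjE exE) (rule that)

text \<open>For large \<open>m\<close> the growth exponent \<open>t \<ge> 1\<close> provides at
  least two indices, and an off-diagonal inner product is a member of \<open>S\<close>.\<close>

lemma combinatorially_nice_nonempty:
  fixes R :: "('a, 'b) ring_scheme"
  assumes "combinatorially_nice R (real_of_int t) S" "t \<ge> 1"
  shows "S \<noteq> {}"
proof -
  obtain c where "c > 0" and c: "\<forall>m>0. \<exists>u v.
    (\<forall>i\<in>{1..nat \<lfloor>c * real m powr real_of_int t\<rfloor>}. u i \<in> vecs R m \<and> v i \<in> vecs R m) \<and>
    (\<forall>i\<in>{1..nat \<lfloor>c * real m powr real_of_int t\<rfloor>}. dot R m (u i) (v i) = \<zero>\<^bsub>R\<^esub>) \<and>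
    (\<forall>i\<in>{1..nat \<lfloor>c * real m powr real_of_int t\<rfloor>}. \<forall>j\<in>{1..nat \<lfloor>c * real m powr real_of_int t\<rfloor>}.
      i \<noteq> j \<longrightarrow> dot R m (u j) (v i) \<in> S)"
    by (rule combinatorially_niceE[OF assms(1)])
  obtain m where "2 / c < real m" using reals_Archimedean2 by blast
  then have m: "2 < c * real m" using \<open>c > 0\<close> by (simp add: field_simps)
  then have "m > 0" by (cases m) auto
  have "real m powr 1 \<le> real m powr real_of_int t"
    using \<open>m > 0\<close> \<open>t \<ge> 1\<close> by (intro powr_mono) auto
  then have "c * real m \<le> c * real m powr real_of_int t" using \<open>c > 0\<close> \<open>m > 0\<close> by simp
  then have "2 \<le> nat \<lfloor>c * real m powr real_of_int t\<rfloor>" using m by linarith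
  then have n: "1 \<in> {1..nat \<lfloor>c * real m powr real_of_int t\<rfloor>}" "2 \<in> {1..nat \<lfloor>c * real m powr real_of_int t\<rfloor>}"
    by simp_all
  obtain u v :: "nat \<Rightarrow> nat \<Rightarrow> 'a" where
    "\<forall>i\<in>{1..nat \<lfloor>c * real m powr real_of_int t\<rfloor>}. \<forall>j\<in>{1..nat \<lfloor>c * real m powr real_of_int t\<rfloor>}.
      i \<noteq> j \<longrightarrow> dot R m (u j) (v i) \<in> S"
    using c[rule_format, OF \<open>m > 0\<close>] by blast
  from bspec[OF bspec[OF this n(1)] n(2)] show ?thesis by auto
qed

text \<open>Since \<beta> is nonzero, the affine map is injective and the intersection can be
  counted by its parameters \<open>s\<close>, the form in which the condition passes to
  residues.\<close>

lemma (in field) algebraically_niceE: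
  assumes "algebraically_nice R k S"
  obtains S\<^sub>0 T where "S\<^sub>0 \<subseteq> carrier R" "S\<^sub>0 \<noteq> {}" "T \<subseteq> carrier R" "odd (card T)" "card T \<le> k"
    "\<forall>\<alpha>\<in>carrier R. \<forall>\<beta>\<in>S. even (card {s \<in> T. \<alpha> \<oplus> \<beta> \<otimes> s \<in> S\<^sub>0})"
proof -
  obtain S\<^sub>0 T where S: "S \<subseteq> carrier R - {\<zero>}" "S\<^sub>0 \<subseteq> carrier R" "S\<^sub>0 \<noteq> {}" "T \<subseteq> carrier R"
      "odd (card T)" "card T \<le> k"
    and even: "\<And>\<alpha> \<beta>. \<alpha> \<in> carrier R \<Longrightarrow> \<beta> \<in> S \<Longrightarrow> even (card (S\<^sub>0 \<inter> affine_image R \<alpha> \<beta> T))"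
    using assms unfolding algebraically_nice_def by blast
  have "even (card {s \<in> T. \<alpha> \<oplus> \<beta> \<otimes> s \<in> S\<^sub>0})" if "\<alpha> \<in> carrier R" "\<beta> \<in> S" for \<alpha> \<beta>
  proof -
    have \<beta>: "\<beta> \<in> carrier R" "\<beta> \<noteq> \<zero>" using that S by auto
    have "inj_on (\<lambda>s. \<alpha> \<oplus> \<beta> \<otimes> s) T"
    proof (rule inj_onI)
      fix s s' assume "s \<in> T" "s' \<in> T" "\<alpha> \<oplus> \<beta> \<otimes> s = \<alpha> \<oplus> \<beta> \<otimes> s'"
      moreover from this have "s \<in> carrier R" "s' \<in> carrier R" using S by auto
      ultimately show "s = s'" using that(1) \<beta> by (simp add: m_lcancel)
    qed
    then have "inj_on (\<lambda>s. \<alpha> \<oplus> \<beta> \<otimes> s) {s \<in> T. \<alpha> \<oplus> \<beta> \<otimes> s \<in> S\<^sub>0}"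
      by (rule inj_on_subset) auto
    moreover have "S\<^sub>0 \<inter> affine_image R \<alpha> \<beta> T = (\<lambda>s. \<alpha> \<oplus> \<beta> \<otimes> s) ` {s \<in> T. \<alpha> \<oplus> \<beta> \<otimes> s \<in> S\<^sub>0}"
      by (auto simp: affine_image_def)
    ultimately show ?thesis using even[OF that] by (simp add: card_image)
  qed
  then show thesis by (intro that[OF S(2-6)] ballI)
qed

text \<open>Collects what one member of the sequence yields, with \<open>p\<close> the
  characteristic: a large \<open>t\<close> forces \<open>p\<close> to be large, and the bound on
  \<open>d\<close> makes \<open>p\<close> large compared with \<open>d\<close>.\<close>

lemma (in field) nice_set_prime:
  assumes fin: "finite (carrier R)" and alg: "algebraically_nice R k S"
    and comb: "combinatorially_nice R (real_of_int t) S" and "t \<ge> 1"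
  shows "\<exists>p d. prime p \<and> t \<le> int ((p - 1) * k) \<and> d > 0 \<and> p dvd 2 ^ d - 1 \<and> k \<ge> 3 \<and>
    real d \<le> 2 * real p powr (1 - 1 / (real k - 1))"
proof -
  obtain S\<^sub>0 T where S0: "S\<^sub>0 \<subseteq> carrier R" "S\<^sub>0 \<noteq> {}"
    and T: "T \<subseteq> carrier R" "odd (card T)" "card T \<le> k"
    and even: "\<forall>\<alpha>\<in>carrier R. \<forall>\<beta>\<in>S. even (card {s \<in> T. \<alpha> \<oplus> \<beta> \<otimes> s \<in> S\<^sub>0})"
    by (rule algebraically_niceE[OF alg])
  have Sc: "S \<subseteq> carrier R - {\<zero>}" using alg by (simp add: algebraically_nice_def)
  obtain \<beta>\<^sub>0 where \<beta>\<^sub>0: "\<beta>\<^sub>0 \<in> S" "\<beta>\<^sub>0 \<in> carrier R" "\<beta>\<^sub>0 \<noteq> \<zero>"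
    using combinatorially_nice_nonempty[OF comb \<open>t \<ge> 1\<close>] Sc by blast
  have finT: "finite T" using T fin finite_subset by blast
  obtain p where p: "prime p"
    and char: "\<And>x i. x \<in> carrier R \<Longrightarrow> int p dvd i \<Longrightarrow> [i] \<cdot> x = \<zero>"
    using finite_field_characteristic[OF fin] by blast
  have "p \<noteq> 2"
  proof
    assume "p = 2"
    have two: "x \<oplus> x = \<zero>" if "x \<in> carrier R" for x
    proof -
      have "x \<oplus> x = [(1 + 1 :: int)] \<cdot> x"
        using that by (simp only: add.int_pow_mult add.int_pow_1)
      then show ?thesis using char[OF that, of 2] \<open>p = 2\<close> by simp
    qed
    \<comment> \<open>A single \<beta> suffices here: dilating \<open>T\<close> by
      \<open>\<beta>\<^sub>0\<close> reduces the condition to plain translates.\<close>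
    have inj: "inj_on (\<lambda>s. \<beta>\<^sub>0 \<otimes> s) T"
      using T(1) \<beta>\<^sub>0 by (intro inj_onI) (auto simp: m_lcancel subset_iff)
    have "S\<^sub>0 = {}"
    proof (rule even_translates_char_two[OF fin two S0(1)])
      show "(\<lambda>s. \<beta>\<^sub>0 \<otimes> s) ` T \<subseteq> carrier R" using T(1) \<beta>\<^sub>0 by auto
      show "odd (card ((\<lambda>s. \<beta>\<^sub>0 \<otimes> s) ` T))" using inj T(2) by (simp add: card_image)
      fix \<alpha> assume \<alpha>: "\<alpha> \<in> carrier R"
      have "{s \<in> (\<lambda>s. \<beta>\<^sub>0 \<otimes> s) ` T. \<alpha> \<oplus> s \<in> S\<^sub>0} = (\<lambda>s. \<beta>\<^sub>0 \<otimes> s) ` {s \<in> T. \<alpha> \<oplus> \<beta>\<^sub>0 \<otimes> s \<in> S\<^sub>0}"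
        by auto
      moreover have "inj_on (\<lambda>s. \<beta>\<^sub>0 \<otimes> s) {s \<in> T. \<alpha> \<oplus> \<beta>\<^sub>0 \<otimes> s \<in> S\<^sub>0}"
        using inj by (rule inj_on_subset) auto
      ultimately show "even (card {s \<in> (\<lambda>s. \<beta>\<^sub>0 \<otimes> s) ` T. \<alpha> \<oplus> s \<in> S\<^sub>0})"
        using even[rule_format, OF \<alpha> \<beta>\<^sub>0(1)] by (simp add: card_image)
    qed
    then show False using S0 by simp
  qed
  obtain f c where f: "additive_mod R p f" and c: "odd (card {x \<in> S\<^sub>0. [f x = c] (mod int p)})"
    by (rule exists_odd_fibre[OF fin p \<open>p \<noteq> 2\<close> char S0])
  define A where "A = {c. odd (card {x \<in> S\<^sub>0. [f x = c] (mod int p)})}"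
  have A: "periodic p A" "A \<noteq> {}" using c by (auto simp: A_def periodic_def cong_def)
  have push: "even (card {s \<in> T. y + f (\<beta> \<otimes> s) \<in> A})" if "\<beta> \<in> S" for y \<beta>
    unfolding A_def mem_Collect_eq
    using that Sc T(1) by (intro even_translates_pushforward[OF fin f S0(1) T(1)] even[rule_format]) auto
  \<comment> \<open>If all the shifts vanished modulo \<open>p\<close>, the count at a point
    \<open>y\<close> of \<open>A\<close> would be \<open>card T\<close>, which is odd.\<close>
  have sep: "\<exists>s\<in>T. \<not> [f (\<beta> \<otimes> s) = 0] (mod int p)" if "\<beta> \<in> S" for \<beta>
  proof (rule ccontr)
    assume "\<not> ?thesis"
    then have zero: "[f (\<beta> \<otimes> s) = 0] (mod int p)" if "s \<in> T" for s using that by blast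
    obtain y where "y \<in> A" using A by blast
    have "y + f (\<beta> \<otimes> s) \<in> A" if "s \<in> T" for s
      using periodic_cong[OF A(1) cong_add[OF cong_refl zero[OF that]], of y] \<open>y \<in> A\<close> by simp
    then have "{s \<in> T. y + f (\<beta> \<otimes> s) \<in> A} = T" by blast
    then show False using push[OF that, of y] T(2) by simp
  qed
  \<comment> \<open>For a single \<open>s\<close>, taking
    \<open>\<alpha> = x \<ominus> \<beta>\<^sub>0 \<otimes> s\<close> with \<open>x\<close> in
    \<open>S\<^sub>0\<close> gives the count 1. Being odd, \<open>card T\<close> is then at least 3,
    and so is \<open>k\<close>.\<close>
  have "card T \<noteq> 1"
  proof
    assume "card T = 1"
    then obtain s where s: "T = {s}" by (auto simp: card_1_singleton_iff)
    obtain x where x: "x \<in> S\<^sub>0" "x \<in> carrier R" using S0 by blast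
    have "s \<in> carrier R" using s T(1) by simp
    then have "(x \<ominus> \<beta>\<^sub>0 \<otimes> s) \<oplus> \<beta>\<^sub>0 \<otimes> s = x" using x \<beta>\<^sub>0 by (simp add: a_minus_def a_assoc l_neg)
    then have "{s \<in> T. (x \<ominus> \<beta>\<^sub>0 \<otimes> s) \<oplus> \<beta>\<^sub>0 \<otimes> s \<in> S\<^sub>0} = {s}" using s x by auto
    moreover have "{s' \<in> T. (x \<ominus> \<beta>\<^sub>0 \<otimes> s) \<oplus> \<beta>\<^sub>0 \<otimes> s' \<in> S\<^sub>0} =
        {s \<in> T. (x \<ominus> \<beta>\<^sub>0 \<otimes> s) \<oplus> \<beta>\<^sub>0 \<otimes> s \<in> S\<^sub>0}" using s by auto
    ultimately show False
      using even[rule_format, of "x \<ominus> \<beta>\<^sub>0 \<otimes> s", OF _ \<beta>\<^sub>0(1)] x \<beta>\<^sub>0 \<open>s \<in> carrier R\<close> by simp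
  qed
  moreover have "card T \<noteq> 0" "card T \<noteq> 2" using T(2) by presburger+
  ultimately have T3: "card T \<ge> 3" by linarith
  obtain d where d: "d > 0" "p dvd 2 ^ d - 1"
    "real d \<le> 2 * real p powr (1 - 1 / real (card T - 1))"
    using mersenne_divisor_of_annihilated[OF p finT T(2) _ A push[OF \<beta>\<^sub>0(1)]] T3 by auto
  \<comment> \<open>The exponent grows with the size of \<open>T\<close>, so \<open>k\<close> may
    replace \<open>card T\<close> in the bound on \<open>d\<close>.\<close>
  have "1 / (real k - 1) \<le> 1 / real (card T - 1)"
    using T3 T(3) by (intro divide_left_mono) (auto simp: of_nat_diff)
  then have "real p powr (1 - 1 / real (card T - 1)) \<le> real p powr (1 - 1 / (real k - 1))"
    using prime_ge_1_nat[OF p] by (intro powr_mono) auto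
  then have "real d \<le> 2 * real p powr (1 - 1 / (real k - 1))" using d(3) by linarith
  moreover have "t \<le> int ((p - 1) * card T)"
  proof -
    obtain c where "c > 0" and c: "\<forall>m>0. \<exists>u v.
    (\<forall>i\<in>{1..nat \<lfloor>c * real m powr real_of_int t\<rfloor>}. u i \<in> vecs R m \<and> v i \<in> vecs R m) \<and>
    (\<forall>i\<in>{1..nat \<lfloor>c * real m powr real_of_int t\<rfloor>}. dot R m (u i) (v i) = \<zero>) \<and>
    (\<forall>i\<in>{1..nat \<lfloor>c * real m powr real_of_int t\<rfloor>}. \<forall>j\<in>{1..nat \<lfloor>c * real m powr real_of_int t\<rfloor>}.
      i \<noteq> j \<longrightarrow> dot R m (u j) (v i) \<in> S)"
      by (rule combinatorially_niceE[OF comb])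
    show ?thesis
    proof (rule powr_growth_exponent_bound[OF \<open>c > 0\<close>])
      show "card (carrier R) > 0" using fin by (auto simp: card_gt_0_iff)
      fix m :: nat assume "m > 0"
      then obtain u v where
        uv: "\<forall>i\<in>{1..nat \<lfloor>c * real m powr real_of_int t\<rfloor>}. u i \<in> vecs R m \<and> v i \<in> vecs R m"
          "\<forall>i\<in>{1..nat \<lfloor>c * real m powr real_of_int t\<rfloor>}. dot R m (u i) (v i) = \<zero>"
          "\<forall>i\<in>{1..nat \<lfloor>c * real m powr real_of_int t\<rfloor>}. \<forall>j\<in>{1..nat \<lfloor>c * real m powr real_of_int t\<rfloor>}.
            i \<noteq> j \<longrightarrow> dot R m (u j) (v i) \<in> S"
        using c by blast
      show "nat \<lfloor>c * real m powr real_of_int t\<rfloor>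
          \<le> (1 + (m * card (carrier R)) ^ (p - 1)) ^ card T"
        by (rule matching_vectors_bound[where u = u and v = v, OF fin p f T(1) sep]) (use uv in blast)+
    qed
  qed
  moreover have "int ((p - 1) * card T) \<le> int ((p - 1) * k)"
    using T(3) by (simp only: of_nat_le_iff mult_le_mono2)
  ultimately show ?thesis using p d(1,2) T3 T(3) by (meson order_trans)
qed

section \<open>Large prime factors and the conclusion\<close>

lemma largest_prime_factor_ge:
  assumes "prime p" "p dvd m" "m > 0"
  shows "p \<le> largest_prime_factor m"
  using assms by (auto simp: largest_prime_factor_def prime_factors_dvd intro!: Max_ge)

text \<open>The two exponents are \<open>(k - 2) / (k - 1)\<close> and
  \<open>(k - 1) / (k - 2)\<close>, hence reciprocal.\<close>

lemma powr_exponent_le: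
  fixes x y k :: real
  assumes "k > 2" "0 \<le> x" "0 \<le> y" "x \<le> y powr (1 - 1 / (k - 1))"
  shows "x powr (1 + 1 / (k - 2)) \<le> y"
proof -
  have "x powr (1 + 1 / (k - 2)) \<le> (y powr (1 - 1 / (k - 1))) powr (1 + 1 / (k - 2))"
    using assms by (intro powr_mono2) auto
  also have "\<dots> = y powr ((1 - 1 / (k - 1)) * (1 + 1 / (k - 2)))" by (simp add: powr_powr)
  also have "(1 - 1 / (k - 1)) * (1 + 1 / (k - 2)) = 1"
  proof -
    have "1 - 1 / (k - 1) = (k - 2) / (k - 1)" "1 + 1 / (k - 2) = (k - 1) / (k - 2)"
      using \<open>k > 2\<close> by (simp_all add: field_simps)
    then show ?thesis using \<open>k > 2\<close> by simp
  qed
  finally show ?thesis using \<open>0 \<le> y\<close> by simp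
qed

lemma strict_mono_on_int_unbounded:
  fixes t :: "nat \<Rightarrow> int"
  assumes "strict_mono_on {1..} t"
  shows "\<exists>i\<ge>1. t i > N"
proof -
  have "t 1 + int n \<le> t (n + 1)" for n
  proof (induction n)
    case (Suc n)
    then show ?case using strict_mono_onD[OF assms, of "n + 1" "n + 2"] by simp
  qed simp
  from this[of "nat (N - t 1 + 1)"] have "t (nat (N - t 1 + 1) + 1) > N" by linarith
  then show ?thesis by (intro exI[of _ "nat (N - t 1 + 1) + 1"]) simp
qed

theorem theorem24:
  fixes k :: nat
  assumes "odd k"
    and "\<exists>(F :: nat \<Rightarrow> ('a, 'b) ring_scheme) (S :: nat \<Rightarrow> 'a set). nice_sequence k F S"
  shows "infinite {t::nat. t > 0 \<and>
           real (largest_prime_factor (2 ^ t - 1)) \<ge> (real t / 2) powr (1 + 1 / (real k - 2))}"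
proof -
  obtain F :: "nat \<Rightarrow> ('a, 'b) ring_scheme" and S :: "nat \<Rightarrow> 'a set" and t :: "nat \<Rightarrow> int"
    where F: "\<And>i. i \<ge> 1 \<Longrightarrow> field (F i) \<and> finite (carrier (F i))"
      and t: "strict_mono_on {1..} t"
      and nice: "\<And>i. i \<ge> 1 \<Longrightarrow> algebraically_nice (F i) k (S i) \<and>
        combinatorially_nice (F i) (real_of_int (t i)) (S i)"
    using assms(2) unfolding nice_sequence_def by blast
  show ?thesis
    unfolding infinite_nat_iff_unbounded
  proof
    fix B :: nat
    \<comment> \<open>For this index the bound on \<open>t i\<close> gives
      \<open>p - 1 > 2 ^ B\<close>. Since \<open>p\<close> divides \<open>2 ^ d - 1\<close>, this
      forces \<open>d > B\<close>, so arbitrarily large exponents occur.\<close>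
    obtain i where i: "i \<ge> 1" "t i > int (2 ^ B * k)"
      using strict_mono_on_int_unbounded[OF t] by blast
    then have "t i \<ge> 1" by linarith
    then obtain p d where p: "prime p" "t i \<le> int ((p - 1) * k)" and d: "d > 0" "p dvd 2 ^ d - 1"
      and k: "k \<ge> 3" and le: "real d \<le> 2 * real p powr (1 - 1 / (real k - 1))"
      using field.nice_set_prime[of "F i" k "S i" "t i"] F[OF i(1)] nice[OF i(1)] by blast
    have "int (2 ^ B * k) < int ((p - 1) * k)" using i(2) p(2) by linarith
    then have "2 ^ B * k < (p - 1) * k" by (simp only: of_nat_less_iff)
    then have "2 ^ B < p - 1" by simp
    have "(2::nat) ^ 1 \<le> 2 ^ d" using d(1) by (intro power_increasing) auto
    then have pos: "(2::nat) ^ d - 1 > 0" by simp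
    then have "p \<le> 2 ^ d - 1" using d(2) by (intro dvd_imp_le)
    then have "(2::nat) ^ B < 2 ^ d" using \<open>2 ^ B < p - 1\<close> by linarith
    then have "B < d" by (rule power_less_imp_less_exp[rotated]) simp
    have "(real d / 2) powr (1 + 1 / (real k - 2)) \<le> real p"
      using k le by (intro powr_exponent_le) auto
    also have "real p \<le> real (largest_prime_factor (2 ^ d - 1))"
      using largest_prime_factor_ge[OF p(1) d(2) pos] by simp
    finally show "\<exists>n>B. n \<in> {t. t > 0 \<and>
        real (largest_prime_factor (2 ^ t - 1)) \<ge> (real t / 2) powr (1 + 1 / (real k - 2))}"
      using \<open>B < d\<close> d(1) by blast
  qed
qed

end
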